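(* Let $F$ be a non-archimedean local field, $d=ef$ with $e,f\ge1$, and let $\mathfrak{A}\subset\mathrm{M}_d(F)$ be the standard principal order with ramification index $e$ and block size $f$, with Jacobson radical $\mathfrak{P}$. Let $m,n\in\mathbb{Z}_{\ge1}$ satisfy $m<n\le2m$. Then there are group isomorphisms $$U^m_{\mathfrak{A}}/U^n_{\mathfrak{A}}\simeq\mathfrak{P}^m/\mathfrak{P}^n,\qquad U^m_{\mathfrak{A}}(1)/U^n_{\mathfrak{A}}(1)\simeq\mathfrak{P}^m[0]/\mathfrak{P}^n[0],$$ where for any $\mathcal{O}_F$-lattice $L$ in $\mathrm{M}_d(F)$, $L[0]$ denotes the sub-$\mathcal{O}_F$-module of trace $0$ elements in $L$.
   Context: $\mathcal{O}_F$ is the ring of integers, $\mathcal{P}_F$ its maximal ideal, $\varpi_F$ a uniformizer. $\mathfrak{A}$ is the ring of $e\times e$ block matrices with $f\times f$ blocks whose blocks on and above the diagonal have entries in $\mathcal{O}_F$ and whose blocks strictly below the diagonal have entries in $\mathcal{P}_F$. Its Jacobson radical is $\mathfrak{P}=\Pi\mathfrak{A}=\mathfrak{A}\Pi$ with $\Pi=\begin{pmatrix}&\mathbf 1_{d-f}\\ \varpi_F\mathbf 1_f&\end{pmatrix}$, and $\mathfrak{P}^n=\Pi^n\mathfrak{A}$. $U^n_{\mathfrak{A}}=(\mathbf 1_d+\mathfrak{P}^n)\cap\mathfrak{A}^\times$ for $n\ge0$, and $U^n_{\mathfrak{A}}(1)=U^n_{\mathfrak{A}}\cap\mathrm{SL}_d(F)$.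 The characteristic of $F$ is arbitrary. *)

theory Defs
  imports "Jordan_Normal_Form.Determinant" "HOL-Algebra.Subrings" "HOL-Algebra.Coset"
begin

section \<open>Non-archimedean local fields\<close>

text \<open>
  A discrete valuation is recorded as an integer-valued function; its value at 0 is
  irrelevant (0 has valuation \<open>\<infinity>\<close>), so every condition below treats 0 separately.
\<close>

definition val_ideal :: "('a::field \<Rightarrow> int) \<Rightarrow> int \<Rightarrow> 'a set" where
  "val_ideal v k = {x. x = 0 \<or> k \<le> v x}"

abbreviation val_integers :: "('a::field \<Rightarrow> int) \<Rightarrow> 'a set" where
  "val_integers v \<equiv> val_ideal v 0"

abbreviation val_maximal :: "('a::field \<Rightarrow> int) \<Rightarrow> 'a set" where
  "val_maximal v \<equiv> val_ideal v 1"

definition val_ring :: "('a::field \<Rightarrow> int) \<Rightarrow> 'a ring" where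
  "val_ring v = \<lparr>carrier = val_integers v, monoid.mult = (*), one = 1, zero = 0, add = (+)\<rparr>"

text \<open>
  A field of arbitrary characteristic with a normalised discrete valuation, complete for
  the induced topology and with finite residue field.
\<close>

locale nonarch_local_field =
  fixes v :: "'a::field \<Rightarrow> int"
  assumes val_mult: "\<lbrakk>x \<noteq> 0; y \<noteq> 0\<rbrakk> \<Longrightarrow> v (x * y) = v x + v y"
    and val_add: "\<lbrakk>x \<noteq> 0; y \<noteq> 0; x + y \<noteq> 0\<rbrakk> \<Longrightarrow> min (v x) (v y) \<le> v (x + y)"
    and val_normalised: "\<exists>x. x \<noteq> 0 \<and> v x = 1"
    and val_complete:
      "(\<And>k. \<exists>N. \<forall>i\<ge>N. \<forall>j\<ge>N. s i - s j \<in> val_ideal v k) \<Longrightarrow>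
         \<exists>l. \<forall>k. \<exists>N. \<forall>i\<ge>N. (s :: nat \<Rightarrow> 'a) i - l \<in> val_ideal v k"
    and finite_residue_field: "finite (carrier (val_ring v Quot val_maximal v))"

definition uniformizer :: "('a::field \<Rightarrow> int) \<Rightarrow> 'a \<Rightarrow> bool" where
  "uniformizer v w \<longleftrightarrow> w \<noteq> 0 \<and> v w = 1"


section \<open>The standard principal order and its filtrations\<close>

text \<open>
  Rows and columns are numbered from 0, so that index \<open>i\<close> lies in block \<open>i div f\<close>.
\<close>

definition principal_order :: "('a::field \<Rightarrow> int) \<Rightarrow> nat \<Rightarrow> nat \<Rightarrow> 'a mat set" where
  "principal_order v e f = {A \<in> carrier_mat (e * f) (e * f). \<forall>i < e * f. \<forall>j < e * f.
     A $$ (i, j) \<in> (if j div f < i div f then val_maximal v else val_integers v)}"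

definition order_ring :: "('a::field \<Rightarrow> int) \<Rightarrow> nat \<Rightarrow> nat \<Rightarrow> 'a mat ring" where
  "order_ring v e f = (ring_mat TYPE('a) (e * f) ()) \<lparr>carrier := principal_order v e f\<rparr>"

definition Pi_mat :: "'a::field \<Rightarrow> nat \<Rightarrow> nat \<Rightarrow> 'a mat" where
  "Pi_mat w e f = four_block_mat
     (0\<^sub>m (e * f - f) f)    (1\<^sub>m (e * f - f))
     (w \<cdot>\<^sub>m 1\<^sub>m f)          (0\<^sub>m f (e * f - f))"

text \<open>
  The ideals \<open>\<PP>\<^sup>n = \<Pi>\<^sup>n \<AA>\<close>. That \<open>\<PP>\<^sup>1\<close> is the Jacobson radical of \<open>\<AA>\<close>, and equals
  \<open>\<AA> \<Pi>\<close>, is proved at the end of this theory.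
\<close>

definition rad_power :: "('a::field \<Rightarrow> int) \<Rightarrow> 'a \<Rightarrow> nat \<Rightarrow> nat \<Rightarrow> nat \<Rightarrow> 'a mat set" where
  "rad_power v w e f n = (\<lambda>A. (Pi_mat w e f ^\<^sub>m n) * A) ` principal_order v e f"

definition unit_filtration :: "('a::field \<Rightarrow> int) \<Rightarrow> 'a \<Rightarrow> nat \<Rightarrow> nat \<Rightarrow> nat \<Rightarrow> 'a mat set" where
  "unit_filtration v w e f n =
     (\<lambda>x. 1\<^sub>m (e * f) + x) ` rad_power v w e f n \<inter> Units (order_ring v e f)"

definition special_linear :: "nat \<Rightarrow> 'a::field mat set" where
  "special_linear d = {A \<in> carrier_mat d d. det A = 1}"

definition unit_filtration_SL :: "('a::field \<Rightarrow> int) \<Rightarrow> 'a \<Rightarrow> nat \<Rightarrow> nat \<Rightarrow> nat \<Rightarrow> 'a mat set" where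
  "unit_filtration_SL v w e f n = unit_filtration v w e f n \<inter> special_linear (e * f)"

definition mat_trace :: "'a::comm_monoid_add mat \<Rightarrow> 'a" where
  "mat_trace A = (\<Sum>i < dim_row A. A $$ (i, i))"

definition trace_zero :: "'a::field mat set \<Rightarrow> 'a mat set" where
  "trace_zero L = {A \<in> L. mat_trace A = 0}"

definition mat_mult_group :: "nat \<Rightarrow> 'a::field mat set \<Rightarrow> 'a mat monoid" where
  "mat_mult_group d U = \<lparr>carrier = U, monoid.mult = (*), one = 1\<^sub>m d\<rparr>"

definition mat_add_group :: "nat \<Rightarrow> 'a::field mat set \<Rightarrow> 'a mat monoid" where
  "mat_add_group d L = \<lparr>carrier = L, monoid.mult = (+), one = 0\<^sub>m d d\<rparr>"


section \<open>The Jacobson radical\<close>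

definition left_ideal :: "'b set \<Rightarrow> ('b, 'c) ring_scheme \<Rightarrow> bool" where
  "left_ideal I R \<longleftrightarrow> additive_subgroup I R \<and>
     (\<forall>a \<in> carrier R. \<forall>x \<in> I. a \<otimes>\<^bsub>R\<^esub> x \<in> I)"

definition maximal_left_ideal :: "'b set \<Rightarrow> ('b, 'c) ring_scheme \<Rightarrow> bool" where
  "maximal_left_ideal I R \<longleftrightarrow> left_ideal I R \<and> I \<noteq> carrier R \<and>
     (\<forall>J. left_ideal J R \<longrightarrow> I \<subseteq> J \<longrightarrow> J = I \<or> J = carrier R)"

definition jacobson_radical :: "('b, 'c) ring_scheme \<Rightarrow> 'b set" where
  "jacobson_radical R = {x \<in> carrier R. \<forall>I. maximal_left_ideal I R \<longrightarrow> x \<in> I}"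


context nonarch_local_field
begin

lemma val_ideal_0 [simp]: "0 \<in> val_ideal v k"
  by (simp add: val_ideal_def)

lemma val_1: "v 1 = 0"
  using val_mult[of 1 1] by simp

lemma val_uminus: "v (- x) = v x"
proof (cases "x = 0")
  case False
  have "v (-1 * -1) = v (-1) + v (-1)" by (rule val_mult) auto
  then have "v (-1) = 0" using val_1 by simp
  then show ?thesis using val_mult[of "-1" x] False by simp
qed auto

lemma val_ideal_add: "x \<in> val_ideal v k \<Longrightarrow> y \<in> val_ideal v k \<Longrightarrow> x + y \<in> val_ideal v k"
  using val_add[of x y] by (cases "x = 0 \<or> y = 0 \<or> x + y = 0") (auto simp: val_ideal_def)

lemma val_ideal_uminus: "x \<in> val_ideal v k \<Longrightarrow> - x \<in> val_ideal v k"
  by (auto simp: val_ideal_def val_uminus)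

lemma val_ideal_mult: "x \<in> val_ideal v k \<Longrightarrow> y \<in> val_ideal v l \<Longrightarrow> x * y \<in> val_ideal v (k + l)"
  using val_mult[of x y] by (cases "x = 0 \<or> y = 0") (auto simp: val_ideal_def)

lemma val_ideal_mono: "l \<le> k \<Longrightarrow> x \<in> val_ideal v k \<Longrightarrow> x \<in> val_ideal v l"
  by (auto simp: val_ideal_def)

lemma val_ideal_sum: "(\<And>i. i \<in> I \<Longrightarrow> g i \<in> val_ideal v k) \<Longrightarrow> sum g I \<in> val_ideal v k"
  by (induction I rule: infinite_finite_induct) (auto intro: val_ideal_add)

lemma val_ideal_prod: "(\<And>i. i \<in> I \<Longrightarrow> g i \<in> val_ideal v 0) \<Longrightarrow> prod g I \<in> val_ideal v 0"
proof (induction I rule: infinite_finite_induct)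
  case (insert x F)
  then show ?case using val_ideal_mult[of "g x" 0 "prod g F" 0] by simp
qed (auto simp: val_ideal_def val_1)

lemma one_val_integers: "1 \<in> val_ideal v 0"
  by (auto simp: val_ideal_def val_1)

lemma one_notin_val_maximal: "1 \<notin> val_ideal v 1"
  by (auto simp: val_ideal_def val_1)

lemma val_inverse: "x \<noteq> 0 \<Longrightarrow> v (inverse x) = - v x"
  using val_mult[of x "inverse x"] val_1 by simp

lemma val_unit_inverse: "x \<in> val_ideal v 0 \<Longrightarrow> x \<notin> val_ideal v 1 \<Longrightarrow> inverse x \<in> val_ideal v 0"
  using val_inverse[of x] by (auto simp: val_ideal_def)

lemma val_int_max: "x \<in> val_ideal v 0 \<Longrightarrow> y \<in> val_ideal v 1 \<Longrightarrow> x * y \<in> val_ideal v 1"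
  using val_ideal_mult[of x 0 y 1] by simp

lemma val_max_int: "x \<in> val_ideal v 1 \<Longrightarrow> y \<in> val_ideal v 0 \<Longrightarrow> x * y \<in> val_ideal v 1"
  using val_ideal_mult[of x 1 y 0] by simp

lemma val_int_int: "x \<in> val_ideal v 0 \<Longrightarrow> y \<in> val_ideal v 0 \<Longrightarrow> x * y \<in> val_ideal v 0"
  using val_ideal_mult[of x 0 y 0] by simp

lemma val_max_imp_int: "x \<in> val_ideal v 1 \<Longrightarrow> x \<in> val_ideal v 0"
  using val_ideal_mono[of 0 1 x] by simp

lemma det_val_integers:
  assumes A: "A \<in> carrier_mat n n" and "\<And>i j. i < n \<Longrightarrow> j < n \<Longrightarrow> A $$ (i, j) \<in> val_ideal v 0"
  shows "det A \<in> val_ideal v 0"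
  unfolding det_def'[OF A]
proof (rule val_ideal_sum)
  fix p assume "p \<in> {p. p permutes {0..<n}}"
  then have "(\<Prod>i = 0..<n. A $$ (i, p i)) \<in> val_ideal v 0"
    by (intro val_ideal_prod assms) (auto simp: permutes_in_image)
  then show "signof p * (\<Prod>i = 0..<n. A $$ (i, p i)) \<in> val_ideal v 0"
    by (auto simp: sign_def val_ideal_uminus)
qed

lemma principal_orderD:
  assumes "A \<in> principal_order v e f"
  shows "A \<in> carrier_mat (e * f) (e * f)"
    "\<And>i j. i < e * f \<Longrightarrow> j < e * f \<Longrightarrow> A $$ (i, j) \<in> val_ideal v 0"
    "\<And>i j. i < e * f \<Longrightarrow> j < e * f \<Longrightarrow> j div f < i div f \<Longrightarrow> A $$ (i, j) \<in> val_ideal v 1"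
  using assms val_max_imp_int unfolding principal_order_def by (auto split: if_splits)

lemma principal_orderI:
  assumes "A \<in> carrier_mat (e * f) (e * f)"
    "\<And>i j. i < e * f \<Longrightarrow> j < e * f \<Longrightarrow> A $$ (i, j) \<in> val_ideal v 0"
    "\<And>i j. i < e * f \<Longrightarrow> j < e * f \<Longrightarrow> j div f < i div f \<Longrightarrow> A $$ (i, j) \<in> val_ideal v 1"
  shows "A \<in> principal_order v e f"
  using assms unfolding principal_order_def by auto

lemma mat_mult_entry:
  assumes "A \<in> carrier_mat n n" "B \<in> carrier_mat n n" "i < n" "j < n"
  shows "(A * B) $$ (i, j) = (\<Sum>l = 0..<n. A $$ (i, l) * B $$ (l, j))"
  using assms by (auto simp: scalar_prod_def)

lemma principal_order_mult:
  assumes A: "A \<in> principal_order v e f" and B: "B \<in> principal_order v e f"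
  shows "A * B \<in> principal_order v e f"
proof (rule principal_orderI)
  show "A * B \<in> carrier_mat (e * f) (e * f)"
    using principal_orderD(1)[OF A] principal_orderD(1)[OF B] by auto
next
  fix i j assume ij: "i < e * f" "j < e * f"
  show "(A * B) $$ (i, j) \<in> val_ideal v 0"
    unfolding mat_mult_entry[OF principal_orderD(1)[OF A] principal_orderD(1)[OF B] ij]
    by (intro val_ideal_sum val_int_int principal_orderD(2)[OF A] principal_orderD(2)[OF B] ij) auto
  assume blk: "j div f < i div f"
  show "(A * B) $$ (i, j) \<in> val_ideal v 1"
    unfolding mat_mult_entry[OF principal_orderD(1)[OF A] principal_orderD(1)[OF B] ij]
  proof (rule val_ideal_sum)
    fix l assume "l \<in> {0..<e * f}"
    then have l: "l < e * f" by simp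
    show "A $$ (i, l) * B $$ (l, j) \<in> val_ideal v 1"
    proof (cases "l div f < i div f")
      case True
      then show ?thesis
        by (intro val_max_int principal_orderD(3)[OF A] principal_orderD(2)[OF B] ij l)
    next
      case False
      with blk have "j div f < l div f" by simp
      then show ?thesis
        by (intro val_int_max principal_orderD(2)[OF A] principal_orderD(3)[OF B] ij l)
    qed
  qed
qed

lemma principal_order_subring: "subring (principal_order v e f) (ring_mat TYPE('a) (e * f) ())"
proof -
  interpret M: ring "ring_mat TYPE('a) (e * f) ()" by (rule ring_mat)
  show ?thesis
  proof (rule M.subringI)
    show "principal_order v e f \<subseteq> carrier (ring_mat TYPE('a) (e * f) ())"
      by (auto simp: ring_mat_simps principal_order_def)
    show "\<one>\<^bsub>ring_mat TYPE('a) (e * f) ()\<^esub> \<in> principal_order v e f"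
      unfolding ring_mat_simps
      by (rule principal_orderI) (auto simp: one_val_integers)
  next
    fix h assume h: "h \<in> principal_order v e f"
    note hD = principal_orderD[OF h]
    have "\<ominus>\<^bsub>ring_mat TYPE('a) (e * f) ()\<^esub> h = - h"
      using hD(1) by (intro M.minus_equality) (auto simp: ring_mat_simps)
    moreover have "- h \<in> principal_order v e f"
      by (rule principal_orderI) (use hD in \<open>auto intro: val_ideal_uminus\<close>)
    ultimately show "\<ominus>\<^bsub>ring_mat TYPE('a) (e * f) ()\<^esub> h \<in> principal_order v e f" by simp
  next
    fix g h assume g: "g \<in> principal_order v e f" and h: "h \<in> principal_order v e f"
    show "g \<otimes>\<^bsub>ring_mat TYPE('a) (e * f) ()\<^esub> h \<in> principal_order v e f"
      using principal_order_mult[OF g h] by (simp add: ring_mat_simps)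
    have "g + h \<in> principal_order v e f"
      by (rule principal_orderI)
        (use principal_orderD[OF g] principal_orderD[OF h] in \<open>auto intro: val_ideal_add\<close>)
    then show "g \<oplus>\<^bsub>ring_mat TYPE('a) (e * f) ()\<^esub> h \<in> principal_order v e f"
      by (simp add: ring_mat_simps)
  qed
qed

lemma order_ring_ring: "ring (order_ring v e f)"
  unfolding order_ring_def by (rule ring.subring_is_ring[OF ring_mat principal_order_subring])

lemma order_ring_simps:
  "carrier (order_ring v e f) = principal_order v e f"
  "mult (order_ring v e f) = (*)"
  "add (order_ring v e f) = (+)"
  "one (order_ring v e f) = 1\<^sub>m (e * f)"
  "zero (order_ring v e f) = 0\<^sub>m (e * f) (e * f)"
  by (simp_all add: order_ring_def ring_mat_simps)

lemma Pi_mat_carrier: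
  assumes "1 \<le> e" shows "Pi_mat w e f \<in> carrier_mat (e * f) (e * f)"
proof -
  have "e * f - f + f = e * f" using assms by (simp add: mult_eq_if)
  then show ?thesis
    unfolding Pi_mat_def carrier_mat_def by simp
qed

lemma Pi_mat_entry:
  assumes "1 \<le> e" "i < e * f" "j < e * f"
  shows "Pi_mat w e f $$ (i, j) =
    (if i < e * f - f then (if j = i + f then 1 else 0)
     else (if j = i - (e * f - f) then w else 0))"
proof -
  have "e * f - f + f = e * f" using assms by (simp add: mult_eq_if)
  then show ?thesis using assms(2,3)
    unfolding Pi_mat_def by (auto simp: index_mat_four_block)
qed

lemma Pi_mat_mult_entry:
  assumes e: "1 \<le> e" and A: "A \<in> carrier_mat (e * f) (e * f)" and ij: "i < e * f" "j < e * f"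
  shows "(Pi_mat w e f * A) $$ (i, j) =
    (if i < e * f - f then A $$ (i + f, j) else w * A $$ (i - (e * f - f), j))"
proof -
  have ef: "f \<le> e * f" using e by simp
  have "(Pi_mat w e f * A) $$ (i, j) = (\<Sum>l = 0..<e * f. Pi_mat w e f $$ (i, l) * A $$ (l, j))"
    by (rule mat_mult_entry[OF Pi_mat_carrier[OF e] A ij])
  also have "\<dots> = (\<Sum>l = 0..<e * f. if l = (if i < e * f - f then i + f else i - (e * f - f))
      then (if i < e * f - f then A $$ (i + f, j) else w * A $$ (i - (e * f - f), j)) else 0)"
    by (rule sum.cong) (auto simp: Pi_mat_entry[OF e ij(1)])
  also have "\<dots> = (if i < e * f - f then A $$ (i + f, j) else w * A $$ (i - (e * f - f), j))"
  proof -
    have "(if i < e * f - f then i + f else i - (e * f - f)) < e * f"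
      using ij by (cases "i < e * f - f"; simp only: if_True if_False; linarith)
    then show ?thesis by (subst sum.delta) auto
  qed
  finally show ?thesis .
qed

lemma mult_Pi_mat_entry:
  assumes e: "1 \<le> e" and A: "A \<in> carrier_mat (e * f) (e * f)" and ij: "i < e * f" "j < e * f"
  shows "(A * Pi_mat w e f) $$ (i, j) =
    (if j < f then A $$ (i, j + (e * f - f)) * w else A $$ (i, j - f))"
proof -
  have ef: "f \<le> e * f" using e by simp
  have "(A * Pi_mat w e f) $$ (i, j) = (\<Sum>l = 0..<e * f. A $$ (i, l) * Pi_mat w e f $$ (l, j))"
    by (rule mat_mult_entry[OF A Pi_mat_carrier[OF e] ij])
  also have "\<dots> = (\<Sum>l = 0..<e * f. if l = (if j < f then j + (e * f - f) else j - f)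
      then (if j < f then A $$ (i, j + (e * f - f)) * w else A $$ (i, j - f)) else 0)"
  proof (rule sum.cong)
    fix l assume "l \<in> {0..<e * f}"
    then have l: "l < e * f" by simp
    show "A $$ (i, l) * Pi_mat w e f $$ (l, j) =
      (if l = (if j < f then j + (e * f - f) else j - f)
       then (if j < f then A $$ (i, j + (e * f - f)) * w else A $$ (i, j - f)) else 0)"
      unfolding Pi_mat_entry[OF e l ij(2)] using l ij ef by auto
  qed simp
  also have "\<dots> = (if j < f then A $$ (i, j + (e * f - f)) * w else A $$ (i, j - f))"
    using ij ef by (subst sum.delta) auto
  finally show ?thesis .
qed

definition rad_entries :: "nat \<Rightarrow> nat \<Rightarrow> 'a mat set" where
  "rad_entries e f = {A \<in> principal_order v e f. \<forall>i < e * f. \<forall>j < e * f.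
     j div f \<le> i div f \<longrightarrow> A $$ (i, j) \<in> val_maximal v}"

lemma uniformizer_mult: "uniformizer v w \<Longrightarrow> x \<in> val_ideal v 0 \<Longrightarrow> w * x \<in> val_ideal v 1"
  using val_max_int[of w x] by (auto simp: uniformizer_def val_ideal_def)

lemma uniformizer_divide: "uniformizer v w \<Longrightarrow> x \<in> val_ideal v 1 \<Longrightarrow> x / w \<in> val_ideal v 0"
  using val_mult[of x "inverse w"] val_inverse[of w]
  by (cases "x = 0") (auto simp: uniformizer_def val_ideal_def divide_inverse)

lemma block_shift:
  assumes "1 \<le> e" "1 \<le> f"
  shows "(i + f) div f = Suc (i div f)"
    and "i < e * f \<Longrightarrow> i div f \<le> e - 1"
    and "i < e * f \<Longrightarrow> e * f - f \<le> i \<Longrightarrow> i div f = e - 1"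
    and "i < f \<Longrightarrow> (i + (e * f - f)) div f = e - 1"
    and "f \<le> i \<Longrightarrow> i div f = Suc ((i - f) div f)"
proof -
  have f: "f > 0" using assms by simp
  have ef: "e * f - f = (e - 1) * f" by (simp add: diff_mult_distrib)
  show "(i + f) div f = Suc (i div f)" using f by simp
  show *: "i div f \<le> e - 1" if "i < e * f"
  proof -
    have "i div f < e" using that by (simp add: less_mult_imp_div_less)
    then show ?thesis by simp
  qed
  show "i div f = e - 1" if "i < e * f" "e * f - f \<le> i"
  proof -
    have "(e - 1) * f div f \<le> i div f" using that ef by (intro div_le_mono) simp
    then show ?thesis using *[OF that(1)] f by simp
  qed
  show "(i + (e * f - f)) div f = e - 1" if "i < f"
    unfolding ef using that f by simp
  show "i div f = Suc ((i - f) div f)" if "f \<le> i"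
    using that f by (simp add: le_div_geq)
qed

lemma rad_power_1_entries:
  assumes w: "uniformizer v w" and e: "1 \<le> e" and f: "1 \<le> f"
  shows "rad_power v w e f 1 = rad_entries e f"
proof -
  have ef: "f \<le> e * f" using e by simp
  note bs = block_shift[OF e f]
  have Pi1: "Pi_mat w e f ^\<^sub>m 1 = Pi_mat w e f"
    using Pi_mat_carrier[OF e, of w f] by simp
  show ?thesis
  proof (intro equalityI subsetI)
    fix X assume "X \<in> rad_power v w e f 1"
    then obtain A where A: "A \<in> principal_order v e f" and X: "X = Pi_mat w e f * A"
      unfolding rad_power_def Pi1 by auto
    note AD = principal_orderD[OF A]
    have ent: "X $$ (i, j) = (if i < e * f - f then A $$ (i + f, j) else w * A $$ (i - (e * f - f), j))"
      if "i < e * f" "j < e * f" for i j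
      unfolding X by (rule Pi_mat_mult_entry[OF e AD(1) that])
    have max: "X $$ (i, j) \<in> val_ideal v 1"
      if ij: "i < e * f" "j < e * f" "j div f \<le> i div f" for i j
    proof (cases "i < e * f - f")
      case True
      then have "j div f < (i + f) div f" "i + f < e * f" using ij bs(1)[of i] by linarith+
      then show ?thesis using True AD(3) ij by (simp add: ent)
    next
      case False
      have "i - (e * f - f) < e * f" using ij by linarith
      then show ?thesis using False AD(2) ij by (simp add: ent uniformizer_mult[OF w])
    qed
    have int: "X $$ (i, j) \<in> val_ideal v 0" if ij: "i < e * f" "j < e * f" for i j
    proof (cases "i < e * f - f")
      case True
      then have "i + f < e * f" by linarith
      then show ?thesis using True AD(2) ij by (simp add: ent)
    next
      case False
      have "i - (e * f - f) < e * f" using ij by linarith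
      then show ?thesis using False AD(2) ij
        by (simp add: ent uniformizer_mult[OF w] val_max_imp_int)
    qed
    have "X \<in> principal_order v e f"
      by (rule principal_orderI)
        (use X AD(1) Pi_mat_carrier[OF e, of w f] int max in \<open>auto intro: less_imp_le\<close>)
    then show "X \<in> rad_entries e f" unfolding rad_entries_def using max by auto
  next
    fix X assume "X \<in> rad_entries e f"
    then have X: "X \<in> principal_order v e f"
      and max: "\<And>i j. i < e * f \<Longrightarrow> j < e * f \<Longrightarrow> j div f \<le> i div f \<Longrightarrow> X $$ (i, j) \<in> val_ideal v 1"
      unfolding rad_entries_def by auto
    note XD = principal_orderD[OF X]
    define A where "A = mat (e * f) (e * f)
      (\<lambda>(i, j). if i < f then X $$ (i + (e * f - f), j) / w else X $$ (i - f, j))"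
    have Ac: "A \<in> carrier_mat (e * f) (e * f)" unfolding A_def by simp
    have "A \<in> principal_order v e f"
    proof (rule principal_orderI[OF Ac])
      fix i j assume ij: "i < e * f" "j < e * f"
      show "A $$ (i, j) \<in> val_ideal v 0"
      proof (cases "i < f")
        case True
        have "i + (e * f - f) < e * f" using True ef by linarith
        moreover have "j div f \<le> (i + (e * f - f)) div f" using bs(4)[OF True] bs(2)[OF ij(2)] by simp
        ultimately have "X $$ (i + (e * f - f), j) \<in> val_ideal v 1" using max ij by blast
        then show ?thesis using True ij by (simp add: A_def uniformizer_divide[OF w])
      next
        case False
        then show ?thesis using ij XD(2)[of "i - f" j] by (simp add: A_def)
      qed
      assume blk: "j div f < i div f"
      then have "f \<le> i" by (metis div_less not_less_zero not_le)
      then show "A $$ (i, j) \<in> val_ideal v 1"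
        using ij max[of "i - f" j] blk bs(5)[of i] by (simp add: A_def)
    qed
    moreover have "X = Pi_mat w e f * A"
    proof (rule eq_matI)
      fix i j assume "i < dim_row (Pi_mat w e f * A)" "j < dim_col (Pi_mat w e f * A)"
      then have ij: "i < e * f" "j < e * f" using Pi_mat_carrier[OF e, of w f] Ac by auto
      have w0: "w \<noteq> 0" using w by (simp add: uniformizer_def)
      show "X $$ (i, j) = (Pi_mat w e f * A) $$ (i, j)"
      proof (cases "i < e * f - f")
        case True
        then have "i + f < e * f" by linarith
        then have "A $$ (i + f, j) = X $$ (i, j)" using ij unfolding A_def by simp
        then show ?thesis unfolding Pi_mat_mult_entry[OF e Ac ij] using True by simp
      next
        case False
        then have "i - (e * f - f) < f" "i - (e * f - f) < e * f"
          "i - (e * f - f) + (e * f - f) = i" using ij by linarith+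
        then have "A $$ (i - (e * f - f), j) = X $$ (i, j) / w" using ij unfolding A_def by simp
        then show ?thesis unfolding Pi_mat_mult_entry[OF e Ac ij] using False w0 by simp
      qed
    qed (use XD(1) Ac Pi_mat_carrier[OF e, of w f] in auto)
    ultimately show "X \<in> rad_power v w e f 1"
      unfolding rad_power_def Pi1 by blast
  qed
qed

lemma order_mult_Pi_entries:
  assumes w: "uniformizer v w" and e: "1 \<le> e" and f: "1 \<le> f"
  shows "(\<lambda>A. A * Pi_mat w e f) ` principal_order v e f = rad_entries e f"
proof -
  have ef: "f \<le> e * f" using e by simp
  note bs = block_shift[OF e f]
  show ?thesis
  proof (intro equalityI subsetI)
    fix X assume "X \<in> (\<lambda>A. A * Pi_mat w e f) ` principal_order v e f"
    then obtain A where A: "A \<in> principal_order v e f" and X: "X = A * Pi_mat w e f"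
      by auto
    note AD = principal_orderD[OF A]
    have ent: "X $$ (i, j) = (if j < f then A $$ (i, j + (e * f - f)) * w else A $$ (i, j - f))"
      if "i < e * f" "j < e * f" for i j
      unfolding X by (rule mult_Pi_mat_entry[OF e AD(1) that])
    have max: "X $$ (i, j) \<in> val_ideal v 1"
      if ij: "i < e * f" "j < e * f" "j div f \<le> i div f" for i j
    proof (cases "j < f")
      case True
      have "j + (e * f - f) < e * f" using True ef by linarith
      then have "w * A $$ (i, j + (e * f - f)) \<in> val_ideal v 1"
        using AD(2) ij by (intro uniformizer_mult[OF w]) auto
      then show ?thesis using True ij by (simp add: ent mult.commute)
    next
      case False
      then have "(j - f) div f < i div f" "j - f < e * f" using ij bs(5)[of j] by linarith+
      then show ?thesis using False AD(3) ij by (simp add: ent)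
    qed
    have int: "X $$ (i, j) \<in> val_ideal v 0" if ij: "i < e * f" "j < e * f" for i j
    proof (cases "j < f")
      case True
      then show ?thesis using max[OF ij] val_max_imp_int by simp
    next
      case False
      have "j - f < e * f" using ij by linarith
      then show ?thesis using False AD(2) ij by (simp add: ent)
    qed
    have "X \<in> principal_order v e f"
      by (rule principal_orderI)
        (use X AD(1) Pi_mat_carrier[OF e, of w f] int max in \<open>auto intro: less_imp_le\<close>)
    then show "X \<in> rad_entries e f" unfolding rad_entries_def using max by auto
  next
    fix X assume "X \<in> rad_entries e f"
    then have X: "X \<in> principal_order v e f"
      and max: "\<And>i j. i < e * f \<Longrightarrow> j < e * f \<Longrightarrow> j div f \<le> i div f \<Longrightarrow> X $$ (i, j) \<in> val_ideal v 1"
      unfolding rad_entries_def by auto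
    note XD = principal_orderD[OF X]
    define A where "A = mat (e * f) (e * f)
      (\<lambda>(i, j). if j < e * f - f then X $$ (i, j + f) else X $$ (i, j - (e * f - f)) / w)"
    have Ac: "A \<in> carrier_mat (e * f) (e * f)" unfolding A_def by simp
    have "A \<in> principal_order v e f"
    proof (rule principal_orderI[OF Ac])
      fix i j assume ij: "i < e * f" "j < e * f"
      show "A $$ (i, j) \<in> val_ideal v 0"
      proof (cases "j < e * f - f")
        case True
        then have "j + f < e * f" by linarith
        then show ?thesis using True ij XD(2)[of i "j + f"] by (simp add: A_def)
      next
        case False
        then have "j - (e * f - f) < f" "j - (e * f - f) < e * f" using ij by linarith+
        then have "X $$ (i, j - (e * f - f)) \<in> val_ideal v 1" using max ij by simp
        then show ?thesis using False ij by (simp add: A_def uniformizer_divide[OF w])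
      qed
      assume blk: "j div f < i div f"
      have j: "j < e * f - f"
        using blk bs(2)[OF ij(1)] bs(3)[OF ij(2)] by linarith
      then have "j + f < e * f" "(j + f) div f \<le> i div f" using bs(1)[of j] blk by linarith+
      then show "A $$ (i, j) \<in> val_ideal v 1"
        using ij max[of i "j + f"] j by (simp add: A_def)
    qed
    moreover have "X = A * Pi_mat w e f"
    proof (rule eq_matI)
      fix i j assume "i < dim_row (A * Pi_mat w e f)" "j < dim_col (A * Pi_mat w e f)"
      then have ij: "i < e * f" "j < e * f" using Pi_mat_carrier[OF e, of w f] Ac by auto
      have w0: "w \<noteq> 0" using w by (simp add: uniformizer_def)
      show "X $$ (i, j) = (A * Pi_mat w e f) $$ (i, j)"
      proof (cases "j < f")
        case True
        then have "j + (e * f - f) < e * f" using ef by linarith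
        then have "A $$ (i, j + (e * f - f)) = X $$ (i, j) / w" using ij unfolding A_def by simp
        then show ?thesis unfolding mult_Pi_mat_entry[OF e Ac ij] using True w0 by simp
      next
        case False
        then have "j - f < e * f - f" "j - f < e * f" "j - f + f = j" using ij by linarith+
        then have "A $$ (i, j - f) = X $$ (i, j)" using ij unfolding A_def by simp
        then show ?thesis unfolding mult_Pi_mat_entry[OF e Ac ij] using False by simp
      qed
    qed (use XD(1) Ac Pi_mat_carrier[OF e, of w f] in auto)
    ultimately show "X \<in> (\<lambda>A. A * Pi_mat w e f) ` principal_order v e f" by blast
  qed
qed

theorem rad_power_1_commute:
  assumes "uniformizer v w" "1 \<le> e" "1 \<le> f"
  shows "rad_power v w e f 1 = (\<lambda>A. A * Pi_mat w e f) ` principal_order v e f"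
  using rad_power_1_entries[OF assms] order_mult_Pi_entries[OF assms] by simp

lemma permutes_block_descent:
  fixes p :: "nat \<Rightarrow> nat"
  assumes p: "p permutes {0..<n}" and "p \<noteq> id"
  shows "\<exists>i<n. p i \<noteq> i \<and> p i div f \<le> i div f"
proof (rule ccontr)
  assume "\<not> ?thesis"
  then have up: "\<And>i. i < n \<Longrightarrow> p i \<noteq> i \<Longrightarrow> i div f < p i div f" by force
  from \<open>p \<noteq> id\<close> obtain i where i: "p i \<noteq> i" by (auto simp: fun_eq_iff)
  then have "i < n" using p by (metis atLeastLessThan_iff le0 permutes_not_in)
  have "(\<Sum>i\<in>{0..<n}. i div f) < (\<Sum>i\<in>{0..<n}. p i div f)"
  proof (rule sum_strict_mono_ex1)
    show "\<forall>x\<in>{0..<n}. x div f \<le> p x div f" using up by (metis atLeastLessThan_iff order.refl less_imp_le)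
    show "\<exists>a\<in>{0..<n}. a div f < p a div f" using up i \<open>i < n\<close> by force
  qed simp
  moreover have "(\<Sum>i\<in>{0..<n}. p i div f) = (\<Sum>i\<in>{0..<n}. i div f)"
    using sum.permute[OF p, of "\<lambda>i. i div f"] by (simp add: comp_def)
  ultimately show False by simp
qed

lemma prod_val_maximal:
  assumes "finite I" "i \<in> I" "g i \<in> val_ideal v 1" "\<And>j. j \<in> I \<Longrightarrow> g j \<in> val_ideal v 0"
  shows "prod g I \<in> val_ideal v 1"
proof -
  have "prod g I = g i * prod g (I - {i})" using assms by (simp add: prod.remove)
  then show ?thesis using assms by (auto intro!: val_max_int val_ideal_prod)
qed

lemma prod_one_plus:
  assumes "finite I" "\<And>i. i \<in> I \<Longrightarrow> g i - 1 \<in> val_ideal v 1"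
  shows "prod g I - 1 \<in> val_ideal v 1"
  using assms
proof (induction I)
  case (insert x F)
  have "g x - 1 + 1 \<in> val_ideal v 0"
    using insert.prems by (intro val_ideal_add one_val_integers val_max_imp_int) auto
  then have "g x * (prod g F - 1) + (g x - 1) \<in> val_ideal v 1"
    using insert by (intro val_ideal_add val_int_max) auto
  then show ?case using insert.hyps by (simp add: algebra_simps)
qed simp

lemma one_plus_rad_unit:
  assumes Y: "Y \<in> rad_entries e f"
  shows "1\<^sub>m (e * f) + Y \<in> Units (order_ring v e f)"
proof -
  let ?n = "e * f"
  let ?A = "1\<^sub>m ?n + Y"
  have Yo: "Y \<in> principal_order v e f"
    and Ym: "\<And>i j. i < ?n \<Longrightarrow> j < ?n \<Longrightarrow> j div f \<le> i div f \<Longrightarrow> Y $$ (i, j) \<in> val_ideal v 1"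
    using Y unfolding rad_entries_def by auto
  note YD = principal_orderD[OF Yo]
  have Ac: "?A \<in> carrier_mat ?n ?n" using YD(1) by simp
  have ent: "?A $$ (i, j) = (if i = j then 1 else 0) + Y $$ (i, j)" if "i < ?n" "j < ?n" for i j
    using YD(1) that by simp
  have Ao: "?A \<in> principal_order v e f"
    by (rule principal_orderI[OF Ac])
      (auto simp: ent one_val_integers intro!: val_ideal_add YD)
  note AD = principal_orderD[OF Ao]
  have "det ?A - 1 \<in> val_ideal v 1"
  proof -
    let ?S = "{p. p permutes {0..<?n}}"
    let ?t = "\<lambda>p. signof p * (\<Prod>i = 0..<?n. ?A $$ (i, p i))"
    have fin: "finite ?S" by (simp add: finite_permutations)
    have "det ?A = ?t id + sum ?t (?S - {id})"
      unfolding det_def'[OF Ac] using fin by (intro sum.remove) (auto simp: permutes_id)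
    moreover have "?t id - 1 \<in> val_ideal v 1"
    proof -
      have "(\<Prod>i = 0..<?n. ?A $$ (i, i)) - 1 \<in> val_ideal v 1"
        by (rule prod_one_plus) (auto simp: ent intro: Ym)
      then show ?thesis by (simp add: sign_id)
    qed
    moreover have "sum ?t (?S - {id}) \<in> val_ideal v 1"
    proof (rule val_ideal_sum)
      fix p assume "p \<in> ?S - {id}"
      then have p: "p permutes {0..<?n}" "p \<noteq> id" by auto
      from permutes_block_descent[OF p, of f] obtain i
        where i: "i < ?n" "p i \<noteq> i" "p i div f \<le> i div f" by blast
      have pn: "p j < ?n" if "j < ?n" for j
        using permutes_in_image[OF p(1), of j] that by simp
      have "(\<Prod>i = 0..<?n. ?A $$ (i, p i)) \<in> val_ideal v 1"
        by (rule prod_val_maximal[of _ i])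
          (use i pn Ym[of i "p i"] AD(2) in \<open>auto simp: ent\<close>)
      then show "?t p \<in> val_ideal v 1" by (auto simp: sign_def val_ideal_uminus)
    qed
    ultimately show ?thesis
      using val_ideal_add[of "?t id - 1" 1 "sum ?t (?S - {id})"] by (simp add: algebra_simps)
  qed
  then have dnot: "det ?A \<notin> val_ideal v 1"
    using val_ideal_add[of "det ?A" 1 "- (det ?A - 1)"] val_ideal_uminus[of "det ?A - 1" 1]
      one_notin_val_maximal by auto
  have dint: "det ?A \<in> val_ideal v 0" using det_val_integers[OF Ac] AD(2) by blast
  define B where "B = inverse (det ?A) \<cdot>\<^sub>m adj_mat ?A"
  have Bc: "B \<in> carrier_mat ?n ?n" unfolding B_def using adj_mat(1)[OF Ac] by simp
  have d0: "det ?A \<noteq> 0" using dnot by auto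
  have BA: "B * ?A = 1\<^sub>m ?n"
  proof -
    have "B * ?A = inverse (det ?A) \<cdot>\<^sub>m (det ?A \<cdot>\<^sub>m 1\<^sub>m ?n)"
      unfolding B_def mult_smult_assoc_mat[OF adj_mat(1)[OF Ac] Ac] adj_mat(3)[OF Ac] ..
    then show ?thesis using d0 by (auto intro!: eq_matI)
  qed
  have AB: "?A * B = 1\<^sub>m ?n" by (rule mat_mult_left_right_inverse[OF Bc Ac BA])
  have B0: "B $$ (i, j) \<in> val_ideal v 0" if ij: "i < ?n" "j < ?n" for i j
  proof -
    have "det (mat_delete ?A j i) \<in> val_ideal v 0"
    proof (rule det_val_integers)
      show "mat_delete ?A j i \<in> carrier_mat (?n - 1) (?n - 1)"
        by (rule carrier_matI) (use Ac YD(1) in \<open>auto simp: mat_delete_def\<close>)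
      fix k l assume kl: "k < ?n - 1" "l < ?n - 1"
      then show "mat_delete ?A j i $$ (k, l) \<in> val_ideal v 0"
        unfolding mat_delete_def using Ac by (auto simp del: index_add_mat intro!: AD(2))
    qed
    then have "cofactor ?A j i \<in> val_ideal v 0"
      unfolding cofactor_def by (cases "even (j + i)") (auto simp: val_ideal_uminus)
    moreover have "B $$ (i, j) = inverse (det ?A) * cofactor ?A j i"
      using ij YD(1) unfolding B_def adj_mat_def by simp
    ultimately show ?thesis
      using val_unit_inverse[OF dint dnot] val_int_int by simp
  qed
  have B1: "B $$ (i, j) \<in> val_ideal v 1" if "i < ?n" "j < ?n" "j div f < i div f" for i j
    using that
  proof (induction "j div f" arbitrary: j rule: less_induct)
    case less
    have BY: "(B * Y) $$ (i, j) \<in> val_ideal v 1"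
      unfolding mat_mult_entry[OF Bc YD(1) less.prems(1,2)]
    proof (rule val_ideal_sum)
      fix l assume "l \<in> {0..<?n}"
      then have l: "l < ?n" by simp
      show "B $$ (i, l) * Y $$ (l, j) \<in> val_ideal v 1"
      proof (cases "l div f < j div f")
        case True
        then show ?thesis
          using less l by (intro val_max_int YD(2)) auto
      next
        case False
        then show ?thesis
          using less.prems l by (intro val_int_max B0 Ym) auto
      qed
    qed
    have "B * ?A = B + B * Y"
      using mult_add_distrib_mat[OF Bc one_carrier_mat YD(1)] Bc by simp
    then have "(B + B * Y) $$ (i, j) = 1\<^sub>m ?n $$ (i, j)" using BA by simp
    moreover have "i \<noteq> j" using less.prems by auto
    ultimately have "B $$ (i, j) + (B * Y) $$ (i, j) = 0"
      using less.prems Bc YD(1) by simp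
    then have "B $$ (i, j) = - (B * Y) $$ (i, j)" by (simp add: eq_neg_iff_add_eq_0)
    then show ?case using BY val_ideal_uminus by simp
  qed
  have "B \<in> principal_order v e f" by (rule principal_orderI[OF Bc B0 B1])
  then show ?thesis using Ao AB BA unfolding Units_def order_ring_simps by auto
qed

theorem jacobson_radical_order:
  assumes w: "uniformizer v w" and e: "1 \<le> e" and f: "1 \<le> f"
  shows "jacobson_radical (order_ring v e f) = rad_power v w e f 1"
  unfolding rad_power_1_entries[OF assms]
proof (intro equalityI subsetI)
  let ?n = "e * f" and ?R = "order_ring v e f"
  interpret R: ring ?R by (rule order_ring_ring)
  fix x assume x: "x \<in> jacobson_radical ?R"
  then have xo: "x \<in> principal_order v e f"
    by (simp add: jacobson_radical_def order_ring_simps)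
  have "x $$ (i, j) \<in> val_ideal v 1" if ij: "i < ?n" "j < ?n" and blk: "j div f = i div f" for i j
  proof -
    define M where "M = {y \<in> principal_order v e f.
      \<forall>l < ?n. l div f = j div f \<longrightarrow> y $$ (l, j) \<in> val_ideal v 1}"
    have M_ge: "y $$ (l, j) \<in> val_ideal v 1"
      if "y \<in> M" "l < ?n" "j div f \<le> l div f" for y l
      using that principal_orderD(3)[of y e f l j] ij unfolding M_def
      by (cases "l div f = j div f") auto
    have M_sub: "subgroup M (add_monoid ?R)"
    proof (rule R.add.subgroupI)
      show "M \<subseteq> carrier ?R" by (auto simp: M_def order_ring_simps)
      have "0\<^sub>m ?n ?n \<in> M" using R.zero_closed ij by (auto simp: M_def order_ring_simps)
      then show "M \<noteq> {}" by auto
    next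
      fix a assume a: "a \<in> M"
      then have ao: "a \<in> principal_order v e f" by (simp add: M_def)
      note aD = principal_orderD[OF ao]
      have "- a \<in> principal_order v e f"
        by (rule principal_orderI) (use aD in \<open>auto intro: val_ideal_uminus\<close>)
      moreover from this have "\<ominus>\<^bsub>?R\<^esub> a = - a"
        using aD(1) ao by (intro R.minus_equality) (auto simp: order_ring_simps)
      moreover have "- a \<in> M"
        using calculation(1) a aD(1) ij by (auto simp: M_def intro: val_ideal_uminus)
      ultimately show "\<ominus>\<^bsub>?R\<^esub> a \<in> M" by simp
    next
      fix a b assume a: "a \<in> M" and b: "b \<in> M"
      then have ab: "a \<in> principal_order v e f" "b \<in> principal_order v e f" by (simp_all add: M_def)
      then have "a + b \<in> principal_order v e f"
        using R.add.m_closed[of a b] by (simp add: order_ring_simps)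
      then show "a \<oplus>\<^bsub>?R\<^esub> b \<in> M"
        using a b principal_orderD(1)[OF ab(1)] principal_orderD(1)[OF ab(2)] ij
        by (auto simp: M_def order_ring_simps intro: val_ideal_add)
    qed
    have left: "left_ideal M ?R"
      unfolding left_ideal_def order_ring_simps
    proof (intro conjI ballI additive_subgroupI M_sub)
      fix a y assume a: "a \<in> principal_order v e f" and y: "y \<in> M"
      then have yo: "y \<in> principal_order v e f" by (simp add: M_def)
      have "(a * y) $$ (l, j) \<in> val_ideal v 1" if l: "l < ?n" "l div f = j div f" for l
        unfolding mat_mult_entry[OF principal_orderD(1)[OF a] principal_orderD(1)[OF yo] l(1) ij(2)]
      proof (rule val_ideal_sum)
        fix k assume "k \<in> {0..<?n}"
        then have k: "k < ?n" by simp
        show "a $$ (l, k) * y $$ (k, j) \<in> val_ideal v 1"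
        proof (cases "k div f < l div f")
          case True
          then show ?thesis
            by (intro val_max_int principal_orderD(3)[OF a] principal_orderD(2)[OF yo] l k ij)
        next
          case False
          then show ?thesis
            using l k by (intro val_int_max principal_orderD(2)[OF a] M_ge y) auto
        qed
      qed
      then show "a * y \<in> M" using principal_order_mult[OF a yo] by (simp add: M_def)
    qed
    have "1\<^sub>m ?n \<notin> M" using ij one_notin_val_maximal by (auto simp: M_def)
    moreover have "1\<^sub>m ?n \<in> carrier ?R" using R.one_closed by (simp add: order_ring_simps)
    ultimately have proper: "M \<noteq> carrier ?R" by blast
    have "J = carrier ?R" if J: "left_ideal J ?R" and MJ: "M \<subseteq> J" and "J \<noteq> M" for J
    proof -
      interpret J: additive_subgroup J ?R using J by (simp add: left_ideal_def)
      from MJ \<open>J \<noteq> M\<close> obtain y where y: "y \<in> J" "y \<notin> M" by blast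
      have yo: "y \<in> principal_order v e f"
        using J.a_subset y(1) by (auto simp: order_ring_simps)
      note yD = principal_orderD[OF yo]
      from y(2) yo obtain l where l: "l < ?n" "l div f = j div f" "y $$ (l, j) \<notin> val_ideal v 1"
        unfolding M_def by blast
      define u where "u = inverse (y $$ (l, j))"
      have "y $$ (l, j) \<noteq> 0" using l(3) by (metis val_ideal_0)
      then have u: "u \<in> val_ideal v 0" "u * y $$ (l, j) = 1"
        using val_unit_inverse[OF yD(2)[OF l(1) ij(2)] l(3)] l(3) unfolding u_def by auto
      define E where "E = mat ?n ?n (\<lambda>(a, b). if a = j \<and> b = l then u else 0)"
      have Eo: "E \<in> principal_order v e f"
        by (rule principal_orderI) (use u(1) l(2) in \<open>auto simp: E_def\<close>)
      note ED = principal_orderD[OF Eo]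
      have Ey: "(E * y) $$ (a, j) = (if a = j then 1 else 0)" if a: "a < ?n" for a
      proof -
        have "(E * y) $$ (a, j) = (\<Sum>k = 0..<?n. E $$ (a, k) * y $$ (k, j))"
          by (rule mat_mult_entry[OF ED(1) yD(1) a ij(2)])
        also have "\<dots> = (\<Sum>k = 0..<?n. if k = l then (if a = j then 1 else 0) else 0)"
          by (rule sum.cong) (use a u(2) in \<open>auto simp: E_def\<close>)
        finally show ?thesis using l(1) by simp
      qed
      have EyJ: "E * y \<in> J" using J Eo y(1) by (auto simp: left_ideal_def order_ring_simps)
      have Eyo: "E * y \<in> principal_order v e f" by (rule principal_order_mult[OF Eo yo])
      note EyD = principal_orderD[OF Eyo]
      have no: "1\<^sub>m ?n - E * y \<in> principal_order v e f"
      proof (rule principal_orderI)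
        fix a b assume ab: "a < ?n" "b < ?n"
        show "(1\<^sub>m ?n - E * y) $$ (a, b) \<in> val_ideal v 0"
          using val_ideal_add[of "1\<^sub>m ?n $$ (a, b)" 0 "- (E * y) $$ (a, b)"]
            val_ideal_uminus[OF EyD(2)[OF ab]] ab EyD(1) ED(1) yD(1)
          by (auto simp: one_val_integers simp del: index_mult_mat(1))
        assume "b div f < a div f"
        then show "(1\<^sub>m ?n - E * y) $$ (a, b) \<in> val_ideal v 1"
          using val_ideal_uminus[OF EyD(3)[OF ab]] ab EyD(1) ED(1) yD(1)
          by (auto simp del: index_mult_mat(1))
      qed (use ED(1) yD(1) in auto)
      have "1\<^sub>m ?n - E * y \<in> M"
        unfolding M_def using no Ey ij EyD(1) ED(1) yD(1)
        by (auto simp del: index_mult_mat(1))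
      then have "(1\<^sub>m ?n - E * y) + E * y \<in> J"
        using J.a_closed[OF subsetD[OF MJ] EyJ] by (simp add: order_ring_simps)
      moreover have "(1\<^sub>m ?n - E * y) + E * y = 1\<^sub>m ?n"
        by (rule eq_matI) (use EyD(1) ED(1) yD(1) in \<open>auto simp del: index_mult_mat(1)\<close>)
      ultimately have one: "\<one>\<^bsub>?R\<^esub> \<in> J" by (simp add: order_ring_simps)
      have "z \<in> J" if "z \<in> carrier ?R" for z
        using J one that R.r_one[OF that] unfolding left_ideal_def by metis
      then show ?thesis using J.a_subset by blast
    qed
    then have "maximal_left_ideal M ?R"
      unfolding maximal_left_ideal_def using left proper by blast
    then have "x \<in> M" using x by (simp add: jacobson_radical_def)
    then show ?thesis using ij blk by (simp add: M_def)
  qed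
  then show "x \<in> rad_entries e f"
    using xo principal_orderD(3)[OF xo] unfolding rad_entries_def by (auto simp: le_less)
next
  let ?n = "e * f" and ?R = "order_ring v e f"
  interpret R: ring ?R by (rule order_ring_ring)
  fix x assume x: "x \<in> rad_entries e f"
  then have xR: "x \<in> carrier ?R" by (simp add: rad_entries_def order_ring_simps)
  have "x \<in> M" if M: "maximal_left_ideal M ?R" for M
  proof (rule ccontr)
    assume xM: "x \<notin> M"
    have Ml: "left_ideal M ?R" "M \<noteq> carrier ?R"
      and max: "\<And>J. left_ideal J ?R \<Longrightarrow> M \<subseteq> J \<Longrightarrow> J = M \<or> J = carrier ?R"
      using M by (auto simp: maximal_left_ideal_def)
    interpret M: additive_subgroup M ?R using Ml by (simp add: left_ideal_def)
    have MR: "\<And>m. m \<in> M \<Longrightarrow> m \<in> carrier ?R" using M.a_subset by blast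
    have Mm: "\<And>a m. a \<in> carrier ?R \<Longrightarrow> m \<in> M \<Longrightarrow> a \<otimes>\<^bsub>?R\<^esub> m \<in> M"
      using Ml by (auto simp: left_ideal_def)
    define J where "J = {m \<oplus>\<^bsub>?R\<^esub> a \<otimes>\<^bsub>?R\<^esub> x | m a. m \<in> M \<and> a \<in> carrier ?R}"
    have JI: "m \<oplus>\<^bsub>?R\<^esub> a \<otimes>\<^bsub>?R\<^esub> x \<in> J" if "m \<in> M" "a \<in> carrier ?R" for m a
      using that unfolding J_def by blast
    have "left_ideal J ?R"
      unfolding left_ideal_def
    proof (intro conjI ballI additive_subgroupI R.add.subgroupI)
      show "J \<subseteq> carrier ?R" using xR MR by (auto simp: J_def)
      show "J \<noteq> {}" using JI[OF M.zero_closed R.zero_closed] by blast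
    next
      fix z assume "z \<in> J"
      then obtain m a where z: "z = m \<oplus>\<^bsub>?R\<^esub> a \<otimes>\<^bsub>?R\<^esub> x" "m \<in> M" "a \<in> carrier ?R"
        unfolding J_def by blast
      have "\<ominus>\<^bsub>?R\<^esub> z = \<ominus>\<^bsub>?R\<^esub> m \<oplus>\<^bsub>?R\<^esub> (\<ominus>\<^bsub>?R\<^esub> a) \<otimes>\<^bsub>?R\<^esub> x"
        using z xR MR by (simp add: R.minus_add R.l_minus)
      then show "\<ominus>\<^bsub>?R\<^esub> z \<in> J" using JI z by simp
    next
      fix z z' assume "z \<in> J" "z' \<in> J"
      then obtain m a m' a' where
        z: "z = m \<oplus>\<^bsub>?R\<^esub> a \<otimes>\<^bsub>?R\<^esub> x" "m \<in> M" "a \<in> carrier ?R" and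
        z': "z' = m' \<oplus>\<^bsub>?R\<^esub> a' \<otimes>\<^bsub>?R\<^esub> x" "m' \<in> M" "a' \<in> carrier ?R"
        unfolding J_def by blast
      have "z \<oplus>\<^bsub>?R\<^esub> z' = (m \<oplus>\<^bsub>?R\<^esub> m') \<oplus>\<^bsub>?R\<^esub> (a \<oplus>\<^bsub>?R\<^esub> a') \<otimes>\<^bsub>?R\<^esub> x"
        using z z' xR MR by (simp add: R.l_distr R.a_ac)
      then show "z \<oplus>\<^bsub>?R\<^esub> z' \<in> J" using JI z z' by simp
    next
      fix b z assume b: "b \<in> carrier ?R" and "z \<in> J"
      then obtain m a where z: "z = m \<oplus>\<^bsub>?R\<^esub> a \<otimes>\<^bsub>?R\<^esub> x" "m \<in> M" "a \<in> carrier ?R"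
        unfolding J_def by blast
      have "b \<otimes>\<^bsub>?R\<^esub> z = b \<otimes>\<^bsub>?R\<^esub> m \<oplus>\<^bsub>?R\<^esub> (b \<otimes>\<^bsub>?R\<^esub> a) \<otimes>\<^bsub>?R\<^esub> x"
        using z xR MR b by (simp add: R.r_distr R.m_assoc)
      then show "b \<otimes>\<^bsub>?R\<^esub> z \<in> J" using JI Mm z b by simp
    qed
    moreover have "M \<subseteq> J"
    proof
      fix m assume "m \<in> M"
      then show "m \<in> J" using JI[of m "\<zero>\<^bsub>?R\<^esub>"] xR MR by simp
    qed
    moreover have "x \<in> J" using JI[of "\<zero>\<^bsub>?R\<^esub>" "\<one>\<^bsub>?R\<^esub>"] xR by simp
    ultimately have "\<one>\<^bsub>?R\<^esub> \<in> J" using max xM by blast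
    then obtain m a where ma: "\<one>\<^bsub>?R\<^esub> = m \<oplus>\<^bsub>?R\<^esub> a \<otimes>\<^bsub>?R\<^esub> x" "m \<in> M" "a \<in> carrier ?R"
      unfolding J_def by blast
    have "m = \<one>\<^bsub>?R\<^esub> \<oplus>\<^bsub>?R\<^esub> (\<ominus>\<^bsub>?R\<^esub> a) \<otimes>\<^bsub>?R\<^esub> x"
      using ma xR MR by (simp add: R.l_minus R.a_assoc R.r_neg)
    moreover have "(\<ominus>\<^bsub>?R\<^esub> a) \<otimes>\<^bsub>?R\<^esub> x \<in> rad_entries e f"
    proof -
      let ?b = "\<ominus>\<^bsub>?R\<^esub> a"
      have b: "?b \<in> principal_order v e f"
        using ma(3) R.a_inv_closed[of a] by (simp add: order_ring_simps)
      have xo: "x \<in> principal_order v e f" using xR by (simp add: order_ring_simps)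
      have "(?b * x) $$ (i, j) \<in> val_ideal v 1"
        if ij: "i < ?n" "j < ?n" "j div f \<le> i div f" for i j
        unfolding mat_mult_entry[OF principal_orderD(1)[OF b] principal_orderD(1)[OF xo] ij(1,2)]
      proof (rule val_ideal_sum)
        fix k assume "k \<in> {0..<?n}"
        then have k: "k < ?n" by simp
        show "?b $$ (i, k) * x $$ (k, j) \<in> val_ideal v 1"
        proof (cases "k div f < i div f")
          case True
          then show ?thesis
            by (intro val_max_int principal_orderD(3)[OF b] principal_orderD(2)[OF xo] k ij)
        next
          case False
          then show ?thesis
            using x ij k by (intro val_int_max principal_orderD(2)[OF b]) (auto simp: rad_entries_def)
        qed
      qed
      then show ?thesis
        using principal_order_mult[OF b xo] by (simp add: rad_entries_def order_ring_simps)
    qed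
    ultimately have "m \<in> Units ?R"
      using one_plus_rad_unit by (simp add: order_ring_simps)
    then obtain b where b: "b \<in> carrier ?R" "b \<otimes>\<^bsub>?R\<^esub> m = \<one>\<^bsub>?R\<^esub>"
      unfolding Units_def by blast
    have one: "\<one>\<^bsub>?R\<^esub> \<in> M" using Mm[OF b(1) ma(2)] b(2) by simp
    have "z \<in> M" if "z \<in> carrier ?R" for z
      using Mm[OF that one] R.r_one[OF that] by simp
    then show False using Ml(2) M.a_subset by blast
  qed
  then show "x \<in> jacobson_radical ?R"
    using xR by (simp add: jacobson_radical_def)
qed

end

end

theory Submission
  imports Defs
begin

text \<open>
  Membership in \<open>\<PP>\<^sup>n\<close> is the entrywise condition \<open>e v(x\<^sub>i\<^sub>j) \<ge> n + i div f - j div f\<close>, which makes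
  \<open>\<PP>\<^sup>m \<PP>\<^sup>n \<subseteq> \<PP>\<^sup>m\<^sup>+\<^sup>n\<close> immediate. Since \<open>n \<le> 2m\<close>, the map \<open>1 + x \<mapsto> x\<close> is additive modulo \<open>\<PP>\<^sup>n\<close>,
  which gives the first isomorphism. In the Leibniz expansion of \<open>det (1 + x)\<close> a nontrivial
  permutation moves at least two indices, and the block indices cancel along it, so that
  \<open>det (1 + x) = 1 + tr x\<close> up to terms with \<open>e v \<ge> 2m\<close>. Hence \<open>det (1 + x) = 1\<close> forces
  \<open>tr x\<close> to be a trace of an element of \<open>\<PP>\<^sup>n\<close>, and \<open>1 + x \<mapsto> x - (tr x) E\<^sub>0\<^sub>0\<close> gives the second
  isomorphism.
\<close>

section \<open>Quotient isomorphisms from maps that are additive modulo a subgroup\<close>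

text \<open>The map \<open>\<phi>\<close> is a homomorphism only after composition with the
  projection to \<open>H Mod N\<close>. That composite is surjective with kernel \<open>K\<close>,
  so the first isomorphism theorem applies and also yields the normality of \<open>K\<close>;
  \<open>N\<close> is normal because \<open>H\<close> is commutative.\<close>

lemma quotient_iso_of_hom_modulo:
  assumes G: "group G" and H: "comm_group H" and N: "subgroup N H"
    and closed: "\<And>a. a \<in> carrier G \<Longrightarrow> \<phi> a \<in> carrier H"
    and mult: "\<And>a b. a \<in> carrier G \<Longrightarrow> b \<in> carrier G \<Longrightarrow>
      \<phi> (a \<otimes>\<^bsub>G\<^esub> b) \<in> N #>\<^bsub>H\<^esub> (\<phi> a \<otimes>\<^bsub>H\<^esub> \<phi> b)"
    and surj: "\<And>y. y \<in> carrier H \<Longrightarrow> \<exists>a \<in> carrier G. \<phi> a \<in> N #>\<^bsub>H\<^esub> y"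
    and ker: "{a \<in> carrier G. \<phi> a \<in> N} = K"
  shows "K \<lhd> G \<and> N \<lhd> H \<and> G Mod K \<cong> H Mod N"
proof -
  interpret G: group G by (rule G)
  interpret H: comm_group H by (rule H)
  interpret N: normal N H by (rule H.subgroup_imp_normal[OF N])
  let ?h = "\<lambda>a. N #>\<^bsub>H\<^esub> \<phi> a"
  have rep: "N #>\<^bsub>H\<^esub> x = N #>\<^bsub>H\<^esub> y" if "x \<in> N #>\<^bsub>H\<^esub> y" "y \<in> carrier H" for x y
    using H.repr_independence[OF that(1) _ N] that(2) by simp
  have hom: "?h \<in> hom G (H Mod N)"
  proof (rule homI)
    fix a assume "a \<in> carrier G"
    then show "?h a \<in> carrier (H Mod N)"
      using closed by (auto simp: FactGroup_def RCOSETS_def)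
  next
    fix a b assume ab: "a \<in> carrier G" "b \<in> carrier G"
    then have "?h (a \<otimes>\<^bsub>G\<^esub> b) = N #>\<^bsub>H\<^esub> (\<phi> a \<otimes>\<^bsub>H\<^esub> \<phi> b)"
      using rep mult closed by simp
    then show "?h (a \<otimes>\<^bsub>G\<^esub> b) = ?h a \<otimes>\<^bsub>H Mod N\<^esub> ?h b"
      using ab closed by (simp add: FactGroup_def N.rcos_sum)
  qed
  interpret h: group_hom G "H Mod N" ?h
    by (intro group_hom.intro group_hom_axioms.intro G N.factorgroup_is_group hom)
  have "?h a = N \<longleftrightarrow> \<phi> a \<in> N" if "a \<in> carrier G" for a
    using H.coset_join1[OF _ closed[OF that] N] H.coset_join2[OF closed[OF that] N] by blast
  then have K: "kernel G (H Mod N) ?h = K"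
    unfolding kernel_def ker[symmetric] by (auto simp: FactGroup_def)
  have "?h ` carrier G = carrier (H Mod N)"
  proof
    show "carrier (H Mod N) \<subseteq> ?h ` carrier G"
      using surj rep by (fastforce simp: FactGroup_def RCOSETS_def)
  qed auto
  then show ?thesis
    using h.FactGroup_iso h.normal_kernel N.normal_axioms unfolding K by blast
qed

section \<open>Multiplicative and additive groups of matrices\<close>

lemma mat_mult_group_is_group:
  assumes "U \<subseteq> carrier_mat d d" "1\<^sub>m d \<in> U" "\<And>A B. A \<in> U \<Longrightarrow> B \<in> U \<Longrightarrow> A * B \<in> U"
    and "\<And>A. A \<in> U \<Longrightarrow> \<exists>B \<in> U. B * A = 1\<^sub>m d"
  shows "group (mat_mult_group d U)"
proof (rule groupI)
  fix A B C
  assume "A \<in> carrier (mat_mult_group d U)" "B \<in> carrier (mat_mult_group d U)"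
    "C \<in> carrier (mat_mult_group d U)"
  then have "A \<in> carrier_mat d d" "B \<in> carrier_mat d d" "C \<in> carrier_mat d d"
    using assms(1) by (auto simp: mat_mult_group_def)
  then show "A \<otimes>\<^bsub>mat_mult_group d U\<^esub> B \<otimes>\<^bsub>mat_mult_group d U\<^esub> C =
      A \<otimes>\<^bsub>mat_mult_group d U\<^esub> (B \<otimes>\<^bsub>mat_mult_group d U\<^esub> C)"
    by (simp add: mat_mult_group_def)
qed (use assms in \<open>auto simp: mat_mult_group_def\<close>)

lemma mat_add_group_is_comm_group:
  fixes L :: "'a::field mat set"
  assumes "L \<subseteq> carrier_mat d d" "0\<^sub>m d d \<in> L" "\<And>A B. A \<in> L \<Longrightarrow> B \<in> L \<Longrightarrow> A + B \<in> L"
    and "\<And>A. A \<in> L \<Longrightarrow> - A \<in> L"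
  shows "comm_group (mat_add_group d L)"
proof (rule comm_groupI)
  fix A B C
  assume "A \<in> carrier (mat_add_group d L)" "B \<in> carrier (mat_add_group d L)"
    "C \<in> carrier (mat_add_group d L)"
  then have "A \<in> carrier_mat d d" "B \<in> carrier_mat d d" "C \<in> carrier_mat d d"
    using assms(1) by (auto simp: mat_add_group_def)
  then show "A \<otimes>\<^bsub>mat_add_group d L\<^esub> B \<otimes>\<^bsub>mat_add_group d L\<^esub> C =
      A \<otimes>\<^bsub>mat_add_group d L\<^esub> (B \<otimes>\<^bsub>mat_add_group d L\<^esub> C)"
    by (simp add: mat_add_group_def)
next
  fix A B
  assume "A \<in> carrier (mat_add_group d L)" "B \<in> carrier (mat_add_group d L)"
  then have "A \<in> carrier_mat d d" "B \<in> carrier_mat d d"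
    using assms(1) by (auto simp: mat_add_group_def)
  then show "A \<otimes>\<^bsub>mat_add_group d L\<^esub> B = B \<otimes>\<^bsub>mat_add_group d L\<^esub> A"
    by (simp add: mat_add_group_def comm_add_mat[of A d d B])
next
  fix A
  assume "A \<in> carrier (mat_add_group d L)"
  then show "\<exists>B\<in>carrier (mat_add_group d L).
      B \<otimes>\<^bsub>mat_add_group d L\<^esub> A = \<one>\<^bsub>mat_add_group d L\<^esub>"
    using assms(1,4) uminus_l_inv_mat[of A d d] by (auto simp: mat_add_group_def intro!: bexI[of _ "- A"])
qed (use assms in \<open>auto simp: mat_add_group_def\<close>)

lemma mat_add_group_subgroup:
  fixes L :: "'a::field mat set"
  assumes L: "comm_group (mat_add_group d L)" "L \<subseteq> carrier_mat d d"
    and "N \<subseteq> L" "0\<^sub>m d d \<in> N" "\<And>A B. A \<in> N \<Longrightarrow> B \<in> N \<Longrightarrow> A + B \<in> N"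
    and "\<And>A. A \<in> N \<Longrightarrow> - A \<in> N"
  shows "subgroup N (mat_add_group d L)"
proof -
  interpret comm_group "mat_add_group d L" by (rule L(1))
  show ?thesis
  proof (rule subgroupI)
    fix A assume A: "A \<in> N"
    have "inv\<^bsub>mat_add_group d L\<^esub> A = - A"
      using A assms uminus_l_inv_mat[of A d d] by (intro inv_equality) (auto simp: mat_add_group_def)
    then show "inv\<^bsub>mat_add_group d L\<^esub> A \<in> N" using assms(6)[OF A] by simp
  qed (use assms in \<open>auto simp: mat_add_group_def\<close>)
qed

lemma mat_add_group_r_cosetI:
  fixes x y :: "'a::field mat"
  assumes "x - y \<in> N" "x \<in> carrier_mat d d" "y \<in> carrier_mat d d"
  shows "x \<in> N #>\<^bsub>mat_add_group d L\<^esub> y"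
proof -
  have "x = (x - y) + y" using assms by (intro eq_matI) auto
  then show ?thesis using assms(1) by (auto simp: r_coset_def mat_add_group_def)
qed

text \<open>This is (1 + x)(1 + y) = 1 + x + y + xy with x = A - 1 and y = B - 1. It isolates xy as
  the defect of additivity of \<open>A \<mapsto> A - 1\<close>.\<close>

lemma mult_minus_one:
  fixes A B :: "'a::field mat"
  assumes "A \<in> carrier_mat d d" "B \<in> carrier_mat d d"
  shows "A * B - 1\<^sub>m d = (A - 1\<^sub>m d) + (B - 1\<^sub>m d) + (A - 1\<^sub>m d) * (B - 1\<^sub>m d)"
proof -
  have "(A - 1\<^sub>m d) * (B - 1\<^sub>m d) = (A - 1\<^sub>m d) * B - (A - 1\<^sub>m d) * 1\<^sub>m d"
    using assms by (intro mult_minus_distrib_mat[of _ d d _ d]) (auto simp: minus_carrier_mat)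
  also have "(A - 1\<^sub>m d) * B = A * B - B"
    using assms minus_mult_distrib_mat[of A d d "1\<^sub>m d" B d] by simp
  also have "(A - 1\<^sub>m d) * 1\<^sub>m d = A - 1\<^sub>m d"
    by (rule right_mult_one_mat[of _ d d]) (simp add: minus_carrier_mat)
  finally have "(A - 1\<^sub>m d) * (B - 1\<^sub>m d) = (A * B - B) - (A - 1\<^sub>m d)" .
  then show ?thesis using assms by (intro eq_matI) (auto simp del: index_mult_mat(1))
qed

section \<open>Traces and the matrices c E_00\<close>

lemma mat_trace_add:
  assumes "A \<in> carrier_mat n n" "B \<in> carrier_mat n n"
  shows "mat_trace (A + B) = mat_trace A + mat_trace B"
  using assms by (auto simp: mat_trace_def sum.distrib)

lemma mat_trace_uminus:
  assumes "A \<in> carrier_mat n n"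
  shows "mat_trace (- A) = - mat_trace (A :: 'a::comm_ring_1 mat)"
  using assms by (auto simp: mat_trace_def sum_negf)

lemma mat_trace_diff:
  assumes "A \<in> carrier_mat n n" "B \<in> carrier_mat n n"
  shows "mat_trace (A - B) = mat_trace A - mat_trace (B :: 'a::comm_ring_1 mat)"
  using assms by (auto simp: mat_trace_def sum_subtractf)

text \<open>Serves to correct a trace by c. The entry sits on the diagonal, so membership of the
  matrix in \<PP>^n asks only for e v(c) \<ge> n (or c = 0).\<close>

definition corner_mat :: "nat \<Rightarrow> 'a::zero \<Rightarrow> 'a mat" where
  "corner_mat d c = mat d d (\<lambda>(i, j). if i = 0 \<and> j = 0 then c else 0)"

lemma corner_mat_carrier [simp]: "corner_mat d c \<in> carrier_mat d d"
  by (simp add: corner_mat_def)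

lemma corner_mat_index [simp]:
  "i < d \<Longrightarrow> j < d \<Longrightarrow> corner_mat d c $$ (i, j) = (if i = 0 \<and> j = 0 then c else 0)"
  "dim_row (corner_mat d c) = d" "dim_col (corner_mat d c) = d"
  by (simp_all add: corner_mat_def)

lemma mat_trace_corner: "0 < d \<Longrightarrow> mat_trace (corner_mat d c) = c"
proof -
  assume d: "0 < d"
  have "mat_trace (corner_mat d c) = (\<Sum>i<d. if i = 0 then c else 0)"
    unfolding mat_trace_def by (intro sum.cong) auto
  also have "\<dots> = c" using d by simp
  finally show ?thesis .
qed

section \<open>Fractional ideals measured by e v\<close>

context nonarch_local_field
begin

text \<open>
  Keeping the factor \<open>e\<close> on the valuation avoids the ceilings \<open>\<lceil>k / e\<rceil>\<close> in the entries of \<open>\<PP>\<^sup>n\<close>.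
\<close>

definition scaled_ideal :: "nat \<Rightarrow> int \<Rightarrow> 'a set" where
  "scaled_ideal e k = {x. x = 0 \<or> k \<le> int e * v x}"

lemma scaled_ideal_0 [simp]: "0 \<in> scaled_ideal e k"
  by (simp add: scaled_ideal_def)

lemma one_scaled_ideal: "k \<le> 0 \<Longrightarrow> 1 \<in> scaled_ideal e k"
  by (simp add: scaled_ideal_def val_1)

lemma scaled_ideal_add:
  assumes "x \<in> scaled_ideal e k" "y \<in> scaled_ideal e k"
  shows "x + y \<in> scaled_ideal e k"
proof (cases "x = 0 \<or> y = 0 \<or> x + y = 0")
  case False
  then have "int e * min (v x) (v y) \<le> int e * v (x + y)"
    by (intro mult_left_mono val_add) auto
  then show ?thesis
    using assms False by (auto simp: scaled_ideal_def min_def split: if_splits)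
qed (use assms in auto)

lemma scaled_ideal_uminus: "x \<in> scaled_ideal e k \<Longrightarrow> - x \<in> scaled_ideal e k"
  by (simp add: scaled_ideal_def val_uminus)

lemma scaled_ideal_diff:
  "x \<in> scaled_ideal e k \<Longrightarrow> y \<in> scaled_ideal e k \<Longrightarrow> x - y \<in> scaled_ideal e k"
  using scaled_ideal_add[of x e k "- y"] scaled_ideal_uminus[of y e k] by simp

lemma scaled_ideal_mult:
  "x \<in> scaled_ideal e k \<Longrightarrow> y \<in> scaled_ideal e l \<Longrightarrow> x * y \<in> scaled_ideal e (k + l)"
  using val_mult[of x y] by (cases "x = 0 \<or> y = 0") (auto simp: scaled_ideal_def algebra_simps)

lemma scaled_ideal_mono: "x \<in> scaled_ideal e k \<Longrightarrow> l \<le> k \<Longrightarrow> x \<in> scaled_ideal e l"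
  by (auto simp: scaled_ideal_def)

lemma scaled_ideal_mult_le:
  "x \<in> scaled_ideal e k \<Longrightarrow> y \<in> scaled_ideal e l \<Longrightarrow> j \<le> k + l \<Longrightarrow> x * y \<in> scaled_ideal e j"
  using scaled_ideal_mult scaled_ideal_mono by blast

lemma scaled_ideal_sum:
  "(\<And>i. i \<in> I \<Longrightarrow> g i \<in> scaled_ideal e k) \<Longrightarrow> sum g I \<in> scaled_ideal e k"
  by (induction I rule: infinite_finite_induct) (auto intro: scaled_ideal_add)

lemma scaled_ideal_prod:
  assumes "finite I" "\<And>i. i \<in> I \<Longrightarrow> g i \<in> scaled_ideal e (k i)"
  shows "prod g I \<in> scaled_ideal e (sum k I)"
  using assms by (induction I) (auto intro: scaled_ideal_mult one_scaled_ideal)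

text \<open>After expansion, every term beyond 1 and the linear ones contains at least two of the
  \<open>g i\<close>; the remaining factors are integral since k \<ge> 0.\<close>

lemma scaled_ideal_prod_one_plus:
  assumes "finite I" "0 \<le> k" "\<And>i. i \<in> I \<Longrightarrow> g i \<in> scaled_ideal e k"
  shows "(\<Prod>i\<in>I. 1 + g i) - 1 - sum g I \<in> scaled_ideal e (2 * k)"
  using assms(1,3)
proof (induction I)
  case (insert x F)
  let ?r = "(\<Prod>i\<in>F. 1 + g i) - 1 - sum g F"
  have x: "g x \<in> scaled_ideal e k" and F: "sum g F \<in> scaled_ideal e k"
    using insert.prems by (auto intro: scaled_ideal_sum)
  have r: "?r \<in> scaled_ideal e (2 * k)" using insert by auto
  have "1 + g x \<in> scaled_ideal e 0"
    using x assms(2) by (intro scaled_ideal_add one_scaled_ideal) (auto intro: scaled_ideal_mono)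
  \<comment> \<open>If r is the remainder for \<open>F\<close>, this expression is exactly the
    remainder for \<open>insert x F\<close>.\<close>
  then have "(1 + g x) * ?r + g x * sum g F \<in> scaled_ideal e (2 * k)"
    using x F r by (intro scaled_ideal_add) (auto intro: scaled_ideal_mult_le)
  then show ?case using insert.hyps by (simp add: algebra_simps)
qed simp

text \<open>Such a u has valuation 0, and 1/u - 1 = -(u - 1)/u.\<close>

lemma scaled_ideal_inverse_one_plus:
  assumes "0 < k" "u - 1 \<in> scaled_ideal e k"
  shows "u \<noteq> 0" "inverse u - 1 \<in> scaled_ideal e k"
proof -
  have *: "x \<noteq> 0 \<and> v x = 0" if "x - 1 \<in> scaled_ideal e k" for x
  proof -
    have "1 \<notin> scaled_ideal e k" using assms(1) by (simp add: scaled_ideal_def val_1)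
    then have x: "x \<noteq> 0"
      using that scaled_ideal_uminus[of "x - 1" e k] by auto
    show ?thesis
    proof (cases "x = 1")
      case False
      have pos: "0 < v (x - 1)"
        using that False assms(1) by (auto simp: scaled_ideal_def zero_less_mult_iff
            dest!: order.strict_trans2[OF assms(1)])
      \<comment> \<open>The ultrametric inequality is used twice, for x = 1 + (x - 1) and for 1 = x
        - (x - 1). As v(x - 1) > 0, the first gives v(x) \<ge> 0 and the second v(x) \<le>
        0.\<close>
      have "min (v 1) (v (x - 1)) \<le> v (1 + (x - 1))"
        using False x by (intro val_add) auto
      moreover have "min (v x) (v (- (x - 1))) \<le> v (x + - (x - 1))"
        using False x by (intro val_add) auto
      ultimately show ?thesis using pos x by (simp add: val_1 val_uminus[of "x - 1", simplified])
    qed (auto simp: val_1)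
  qed
  show u: "u \<noteq> 0" using *[OF assms(2)] by simp
  have "inverse u \<in> scaled_ideal e 0"
    using *[OF assms(2)] val_inverse[OF u] by (simp add: scaled_ideal_def)
  then have "- (u - 1) * inverse u \<in> scaled_ideal e k"
    using scaled_ideal_uminus[OF assms(2)] by (auto intro: scaled_ideal_mult_le)
  then show "inverse u - 1 \<in> scaled_ideal e k" using u by (simp add: algebra_simps)
qed

section \<open>The powers of the radical described by entries\<close>

text \<open>The entrywise form of \<PP>^n. The shift by a difference of block indices telescopes in
  matrix products and sums to zero along a permutation.\<close>

definition graded_mats :: "nat \<Rightarrow> nat \<Rightarrow> nat \<Rightarrow> 'a mat set" where
  "graded_mats e f n = {A \<in> carrier_mat (e * f) (e * f). \<forall>i < e * f. \<forall>j < e * f.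
     A $$ (i, j) \<in> scaled_ideal e (int n + int (i div f) - int (j div f))}"

lemma graded_matsD:
  assumes "A \<in> graded_mats e f n"
  shows "A \<in> carrier_mat (e * f) (e * f)"
    "\<And>i j. i < e * f \<Longrightarrow> j < e * f \<Longrightarrow>
      A $$ (i, j) \<in> scaled_ideal e (int n + int (i div f) - int (j div f))"
  using assms unfolding graded_mats_def by auto

lemma graded_matsI:
  assumes "A \<in> carrier_mat (e * f) (e * f)"
    "\<And>i j. i < e * f \<Longrightarrow> j < e * f \<Longrightarrow>
      A $$ (i, j) \<in> scaled_ideal e (int n + int (i div f) - int (j div f))"
  shows "A \<in> graded_mats e f n"
  using assms unfolding graded_mats_def by auto

text \<open>The two bounds say that k is the ceiling of l/e, and v is integer-valued.\<close>

lemma scaled_ideal_eq_val_ideal: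
  fixes k l :: int
  assumes "int e * (k - 1) < l" "l \<le> int e * k" "0 < e"
  shows "scaled_ideal e l = val_ideal v k"
proof -
  have "l \<le> int e * t \<longleftrightarrow> k \<le> t" for t
  proof
    assume "l \<le> int e * t"
    then have "int e * (k - 1) < int e * t" using assms(1) by linarith
    then show "k \<le> t" using assms(3) by (simp add: mult_less_cancel_left)
  next
    assume "k \<le> t"
    then have "int e * k \<le> int e * t" by (simp add: mult_left_mono)
    then show "l \<le> int e * t" using assms(2) by linarith
  qed
  then show ?thesis by (auto simp: scaled_ideal_def val_ideal_def)
qed

text \<open>A difference of block indices lies strictly between -e and e, so its quotient by e has
  ceiling 1 when the difference is positive and 0 otherwise.\<close>

lemma graded_mats_0:
  assumes "1 \<le> e" "1 \<le> f"
  shows "graded_mats e f 0 = principal_order v e f"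
proof -
  have "scaled_ideal e (int 0 + int (i div f) - int (j div f)) =
      (if j div f < i div f then val_maximal v else val_integers v)"
    if "i < e * f" "j < e * f" for i j
  proof -
    have "i div f < e" "j div f < e" using that by (simp_all add: less_mult_imp_div_less)
    then show ?thesis
      using scaled_ideal_eq_val_ideal[of e 1] scaled_ideal_eq_val_ideal[of e 0] by auto
  qed
  then show ?thesis unfolding graded_mats_def principal_order_def by auto
qed

text \<open>Left multiplication by \<Pi> moves each block row up by one and wraps the first one to
  the bottom with a factor \<open>w\<close>. Moving up gains one degree; the wrap gains e from
  \<open>w\<close> and loses e - 1 from the block index, again a gain of one.\<close>

lemma Pi_mult_graded_mats:
  assumes w: "uniformizer v w" and e: "1 \<le> e" and f: "1 \<le> f"
  shows "(\<lambda>A. Pi_mat w e f * A) ` graded_mats e f n = graded_mats e f (Suc n)"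
proof -
  have ef: "f \<le> e * f" using e by simp
  note bs = block_shift[OF e f]
  have w0: "w \<noteq> 0" and vw: "v w = 1" using w by (simp_all add: uniformizer_def)
  have w_mem: "w \<in> scaled_ideal e (int e)" and iw_mem: "inverse w \<in> scaled_ideal e (- int e)"
    using w0 vw val_inverse[OF w0] by (simp_all add: scaled_ideal_def)
  show ?thesis
  proof (intro equalityI subsetI)
    fix X assume "X \<in> (\<lambda>A. Pi_mat w e f * A) ` graded_mats e f n"
    then obtain A where A: "A \<in> graded_mats e f n" and X: "X = Pi_mat w e f * A" by auto
    note AD = graded_matsD[OF A]
    show "X \<in> graded_mats e f (Suc n)"
    proof (rule graded_matsI)
      show "X \<in> carrier_mat (e * f) (e * f)"
        using X AD(1) Pi_mat_carrier[OF e, of w f] by auto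
      fix i j assume ij: "i < e * f" "j < e * f"
      show "X $$ (i, j) \<in> scaled_ideal e (int (Suc n) + int (i div f) - int (j div f))"
      proof (cases "i < e * f - f")
        case True
        then have "i + f < e * f" by linarith
        from AD(2)[OF this ij(2)] show ?thesis
          unfolding X Pi_mat_mult_entry[OF e AD(1) ij] using True bs(1)[of i]
          by (simp add: algebra_simps)
      next
        case False
        then have k: "i - (e * f - f) < e * f" "i - (e * f - f) < f" using ij by linarith+
        have "i div f = e - 1" using bs(3) False ij by simp
        then have "w * A $$ (i - (e * f - f), j) \<in>
            scaled_ideal e (int (Suc n) + int (i div f) - int (j div f))"
          using e k by (intro scaled_ideal_mult_le[OF w_mem AD(2)[OF k(1) ij(2)]]) simp
        then show ?thesis
          unfolding X Pi_mat_mult_entry[OF e AD(1) ij] using False by simp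
      qed
    qed
  next
    fix X assume X: "X \<in> graded_mats e f (Suc n)"
    note XD = graded_matsD[OF X]
    \<comment> \<open>The entries of \<Pi>^(-1) X: block rows move down, and the last one returns to
      the top divided by \<open>w\<close>.\<close>
    define A where "A = mat (e * f) (e * f)
      (\<lambda>(i, j). if i < f then inverse w * X $$ (i + (e * f - f), j) else X $$ (i - f, j))"
    have Ac: "A \<in> carrier_mat (e * f) (e * f)" unfolding A_def by simp
    have "A \<in> graded_mats e f n"
    proof (rule graded_matsI[OF Ac])
      fix i j assume ij: "i < e * f" "j < e * f"
      show "A $$ (i, j) \<in> scaled_ideal e (int n + int (i div f) - int (j div f))"
      proof (cases "i < f")
        case True
        then have k: "i + (e * f - f) < e * f" using ef by linarith
        have "inverse w * X $$ (i + (e * f - f), j) \<in>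
            scaled_ideal e (int n + int (i div f) - int (j div f))"
          using e True bs(4)[OF True]
          by (intro scaled_ideal_mult_le[OF iw_mem XD(2)[OF k ij(2)]]) simp
        then show ?thesis using True ij by (simp add: A_def)
      next
        case False
        then have "i - f < e * f" "f \<le> i" using ij by linarith+
        then show ?thesis using XD(2)[of "i - f" j] False ij bs(5)[of i]
          by (simp add: A_def algebra_simps)
      qed
    qed
    moreover have "X = Pi_mat w e f * A"
    proof (rule eq_matI)
      fix i j assume "i < dim_row (Pi_mat w e f * A)" "j < dim_col (Pi_mat w e f * A)"
      then have ij: "i < e * f" "j < e * f" using Pi_mat_carrier[OF e, of w f] Ac by auto
      show "X $$ (i, j) = (Pi_mat w e f * A) $$ (i, j)"
      proof (cases "i < e * f - f")
        case True
        then have "i + f < e * f" by linarith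
        then have "A $$ (i + f, j) = X $$ (i, j)" using ij unfolding A_def by simp
        then show ?thesis unfolding Pi_mat_mult_entry[OF e Ac ij] using True by simp
      next
        case False
        then have "i - (e * f - f) < f" "i - (e * f - f) < e * f"
          "i - (e * f - f) + (e * f - f) = i" using ij by linarith+
        then have "A $$ (i - (e * f - f), j) = inverse w * X $$ (i, j)"
          using ij unfolding A_def by simp
        then show ?thesis unfolding Pi_mat_mult_entry[OF e Ac ij] using False w0 by simp
      qed
    qed (use XD(1) Ac Pi_mat_carrier[OF e, of w f] in auto)
    ultimately show "X \<in> (\<lambda>A. Pi_mat w e f * A) ` graded_mats e f n" by blast
  qed
qed

lemma rad_power_eq_graded_mats:
  assumes w: "uniformizer v w" and e: "1 \<le> e" and f: "1 \<le> f"
  shows "rad_power v w e f n = graded_mats e f n"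
proof (induction n)
  case 0
  have "rad_power v w e f 0 = principal_order v e f"
    using Pi_mat_carrier[OF e, of w f] principal_orderD(1)[of _ e f]
    by (force simp: rad_power_def)
  then show ?case using graded_mats_0[OF e f] by simp
next
  case (Suc n)
  let ?Pi = "Pi_mat w e f"
  have Pi: "?Pi \<in> carrier_mat (e * f) (e * f)" by (rule Pi_mat_carrier[OF e])
  \<comment> \<open>Matrix powers append the new factor on the right, whereas the induction needs it
    on the left.\<close>
  have comm: "?Pi ^\<^sub>m k * ?Pi = ?Pi * ?Pi ^\<^sub>m k" for k
  proof (induction k)
    case (Suc k)
    then show ?case
      using assoc_mult_mat[OF Pi pow_carrier_mat[OF Pi, of k] Pi] by simp
  qed (use Pi in simp)
  have "?Pi ^\<^sub>m Suc n * A = ?Pi * (?Pi ^\<^sub>m n * A)" if "A \<in> principal_order v e f" for A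
    using assoc_mult_mat[OF Pi pow_carrier_mat[OF Pi, of n] principal_orderD(1)[OF that]]
    by (simp add: comm)
  then have "rad_power v w e f (Suc n) = (\<lambda>A. ?Pi * A) ` rad_power v w e f n"
    unfolding rad_power_def image_image by (intro image_cong) auto
  then show ?case using Suc Pi_mult_graded_mats[OF assms] by simp
qed

lemma graded_mats_zero: "0\<^sub>m (e * f) (e * f) \<in> graded_mats e f n"
  by (rule graded_matsI) auto

lemma graded_mats_add:
  assumes "A \<in> graded_mats e f n" "B \<in> graded_mats e f n"
  shows "A + B \<in> graded_mats e f n"
  using graded_matsD[OF assms(1)] graded_matsD[OF assms(2)]
  by (intro graded_matsI) (auto intro: scaled_ideal_add)

lemma graded_mats_uminus:
  assumes "A \<in> graded_mats e f n"
  shows "- A \<in> graded_mats e f n"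
  using graded_matsD[OF assms] by (intro graded_matsI) (auto intro: scaled_ideal_uminus)

lemma graded_mats_diff:
  assumes "A \<in> graded_mats e f n" "B \<in> graded_mats e f n"
  shows "A - B \<in> graded_mats e f n"
  using graded_matsD[OF assms(1)] graded_matsD[OF assms(2)]
  by (intro graded_matsI) (auto intro: scaled_ideal_diff)

lemma graded_mats_mono:
  assumes "A \<in> graded_mats e f n" "m \<le> n"
  shows "A \<in> graded_mats e f m"
proof (rule graded_matsI)
  fix i j assume "i < e * f" "j < e * f"
  then show "A $$ (i, j) \<in> scaled_ideal e (int m + int (i div f) - int (j div f))"
    using scaled_ideal_mono[OF graded_matsD(2)[OF assms(1)]] assms(2) by simp
qed (rule graded_matsD(1)[OF assms(1)])

text \<open>In each summand of an entry of the product, the two shifts by the middle block index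
  cancel.\<close>

lemma graded_mats_mult:
  assumes A: "A \<in> graded_mats e f m" and B: "B \<in> graded_mats e f n"
  shows "A * B \<in> graded_mats e f (m + n)"
proof (rule graded_matsI)
  show "A * B \<in> carrier_mat (e * f) (e * f)"
    using graded_matsD(1)[OF A] graded_matsD(1)[OF B] by auto
  fix i j assume ij: "i < e * f" "j < e * f"
  show "(A * B) $$ (i, j) \<in> scaled_ideal e (int (m + n) + int (i div f) - int (j div f))"
    unfolding mat_mult_entry[OF graded_matsD(1)[OF A] graded_matsD(1)[OF B] ij]
    by (intro scaled_ideal_sum scaled_ideal_mult_le[OF graded_matsD(2)[OF A] graded_matsD(2)[OF B]])
      (use ij in auto)
qed

lemma corner_mat_graded: "c \<in> scaled_ideal e (int n) \<Longrightarrow> corner_mat (e * f) c \<in> graded_mats e f n"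
  by (rule graded_matsI) auto

lemma mat_trace_graded:
  assumes "A \<in> graded_mats e f n"
  shows "mat_trace A \<in> scaled_ideal e (int n)"
proof -
  have "A $$ (i, i) \<in> scaled_ideal e (int n)" if "i < e * f" for i
    using graded_matsD(2)[OF assms that that] by simp
  then show ?thesis
    using graded_matsD(1)[OF assms] unfolding mat_trace_def by (intro scaled_ideal_sum) auto
qed

section \<open>The determinant of 1 + x to first order\<close>

text \<open>In the Leibniz formula the identity contributes 1 + tr x up to terms at least quadratic
  in the diagonal entries; each other permutation contributes only to the error.\<close>

lemma det_one_plus_graded:
  assumes x: "x \<in> graded_mats e f m"
  shows "det (1\<^sub>m (e * f) + x) - 1 - mat_trace x \<in> scaled_ideal e (2 * int m)"
proof -
  let ?n = "e * f" and ?A = "1\<^sub>m (e * f) + x"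
  note xD = graded_matsD[OF x]
  have Ac: "?A \<in> carrier_mat ?n ?n" using xD(1) by simp
  have ent: "?A $$ (i, j) = (if i = j then 1 else 0) + x $$ (i, j)" if "i < ?n" "j < ?n" for i j
    using xD(1) that by simp
  let ?S = "{p. p permutes {0..<?n}}"
  let ?t = "\<lambda>p. signof p * (\<Prod>i = 0..<?n. ?A $$ (i, p i))"
  have fin: "finite ?S" by (simp add: finite_permutations)
  have "det ?A = ?t id + sum ?t (?S - {id})"
    unfolding det_def'[OF Ac] using fin by (intro sum.remove) (auto simp: permutes_id)
  moreover have "?t id - 1 - mat_trace x \<in> scaled_ideal e (2 * int m)"
  proof -
    have "(\<Prod>i\<in>{0..<?n}. 1 + x $$ (i, i)) - 1 - (\<Sum>i\<in>{0..<?n}. x $$ (i, i))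
        \<in> scaled_ideal e (2 * int m)"
      by (rule scaled_ideal_prod_one_plus) (use xD(2) in \<open>force+\<close>)
    moreover have "?t id = (\<Prod>i\<in>{0..<?n}. 1 + x $$ (i, i))"
      by (auto simp: sign_id ent simp del: index_add_mat intro!: prod.cong)
    moreover have "mat_trace x = (\<Sum>i\<in>{0..<?n}. x $$ (i, i))"
      using xD(1) by (auto simp: mat_trace_def atLeast0LessThan)
    ultimately show ?thesis by simp
  qed
  moreover have "sum ?t (?S - {id}) \<in> scaled_ideal e (2 * int m)"
  proof (rule scaled_ideal_sum)
    fix p assume "p \<in> ?S - {id}"
    then have p: "p permutes {0..<?n}" "p \<noteq> id" by auto
    have pn: "p j < ?n" if "j < ?n" for j
      using permutes_in_image[OF p(1), of j] that by simp
    define M where "M = {i \<in> {0..<?n}. p i \<noteq> i}"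
    \<comment> \<open>Lower bound for e v of the i-th factor. At a fixed point the factor is 1 plus
      a diagonal entry, so the bound is 0; at a moved index the factor is an entry of x and
      contributes m and the block shift.\<close>
    let ?k = "\<lambda>i. (if i \<in> M then int m else 0) + (int (i div f) - int (p i div f))"
    have "(\<Prod>i = 0..<?n. ?A $$ (i, p i)) \<in> scaled_ideal e (sum ?k {0..<?n})"
    proof (rule scaled_ideal_prod)
      fix i assume "i \<in> {0..<?n}"
      then have i: "i < ?n" by simp
      show "?A $$ (i, p i) \<in> scaled_ideal e (?k i)"
      proof (cases "p i = i")
        case True
        then have "1 + x $$ (i, i) \<in> scaled_ideal e 0"
          using xD(2)[OF i i]
          by (intro scaled_ideal_add one_scaled_ideal) (auto intro: scaled_ideal_mono)
        then show ?thesis using True i ent[OF i i] by (simp add: M_def del: index_add_mat)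
      next
        case False
        then show ?thesis
          using xD(2)[OF i pn[OF i]] i ent[OF i pn[OF i]]
          by (simp add: M_def algebra_simps del: index_add_mat)
      qed
    qed simp
    moreover have "2 * int m \<le> sum ?k {0..<?n}"
    proof -
      \<comment> \<open>The block shifts sum to zero because p permutes the indices, which leaves m
        times the number of moved indices.\<close>
      have "sum ?k {0..<?n} = (\<Sum>i\<in>{0..<?n}. if i \<in> M then int m else 0) +
          ((\<Sum>i\<in>{0..<?n}. int (i div f)) - (\<Sum>i\<in>{0..<?n}. int (p i div f)))"
        by (simp only: sum.distrib sum_subtractf)
      also have "(\<Sum>i\<in>{0..<?n}. int (p i div f)) = (\<Sum>i\<in>{0..<?n}. int (i div f))"
        using sum.permute[OF p(1), of "\<lambda>i. int (i div f)"] by (simp add: comp_def)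
      also have "(\<Sum>i\<in>{0..<?n}. if i \<in> M then int m else 0) = int (card M) * int m"
        by (subst sum.inter_restrict[symmetric]) (auto simp: M_def Int_def)
      finally have sum: "sum ?k {0..<?n} = int (card M) * int m" by simp
      \<comment> \<open>A moved index and its image are two distinct elements of \<open>M\<close>,
        by injectivity of p.\<close>
      from p(2) obtain i where i: "p i \<noteq> i" by (auto simp: fun_eq_iff)
      then have "i \<in> {0..<?n}" using p(1) by (metis permutes_not_in)
      moreover from this have "p i \<in> {0..<?n}" using pn by simp
      moreover have "p (p i) \<noteq> p i" using i permutes_inj[OF p(1)] by (auto dest: injD)
      ultimately have "{i, p i} \<subseteq> M" using i by (auto simp: M_def)
      then have "card {i, p i} \<le> card M" by (intro card_mono) (auto simp: M_def)
      then have "2 \<le> int (card M)" using i by simp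
      then show ?thesis unfolding sum by (intro mult_right_mono) auto
    qed
    ultimately have "(\<Prod>i = 0..<?n. ?A $$ (i, p i)) \<in> scaled_ideal e (2 * int m)"
      by (rule scaled_ideal_mono)
    then show "?t p \<in> scaled_ideal e (2 * int m)"
      by (auto simp: sign_def simp del: index_add_mat intro: scaled_ideal_uminus)
  qed
  ultimately show ?thesis
    using scaled_ideal_add[of "?t id - 1 - mat_trace x" e "2 * int m" "sum ?t (?S - {id})"]
    by (simp add: algebra_simps)
qed

section \<open>The unit groups\<close>

text \<open>For m \<ge> 1 the ideal \<PP>^m lies in the Jacobson radical, and one plus an element of
  the radical is a unit of the order.\<close>

lemma unit_filtration_iff:
  assumes w: "uniformizer v w" and e: "1 \<le> e" and f: "1 \<le> f" and m: "1 \<le> m"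
  shows "A \<in> unit_filtration v w e f m \<longleftrightarrow>
    A \<in> carrier_mat (e * f) (e * f) \<and> A - 1\<^sub>m (e * f) \<in> graded_mats e f m"
proof
  assume "A \<in> unit_filtration v w e f m"
  then obtain x where x: "x \<in> graded_mats e f m" "A = 1\<^sub>m (e * f) + x"
    by (auto simp: unit_filtration_def rad_power_eq_graded_mats[OF w e f])
  moreover have "A - 1\<^sub>m (e * f) = x"
    unfolding x(2) using graded_matsD(1)[OF x(1)] by (intro eq_matI) auto
  ultimately show "A \<in> carrier_mat (e * f) (e * f) \<and> A - 1\<^sub>m (e * f) \<in> graded_mats e f m"
    using graded_matsD(1)[OF x(1)] by simp
next
  assume A: "A \<in> carrier_mat (e * f) (e * f) \<and> A - 1\<^sub>m (e * f) \<in> graded_mats e f m"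
  then have eq: "A = 1\<^sub>m (e * f) + (A - 1\<^sub>m (e * f))" by (intro eq_matI) auto
  have "A - 1\<^sub>m (e * f) \<in> rad_entries e f"
    using A m graded_mats_mono rad_power_1_entries[OF w e f] rad_power_eq_graded_mats[OF w e f]
    by metis
  then have "1\<^sub>m (e * f) + (A - 1\<^sub>m (e * f)) \<in> Units (order_ring v e f)"
    by (rule one_plus_rad_unit)
  then show "A \<in> unit_filtration v w e f m"
    unfolding unit_filtration_def rad_power_eq_graded_mats[OF w e f] using A eq by auto
qed

lemma unit_filtration_mult:
  assumes "uniformizer v w" "1 \<le> e" "1 \<le> f" "1 \<le> m"
    and A: "A \<in> unit_filtration v w e f m" and B: "B \<in> unit_filtration v w e f m"
  shows "A * B \<in> unit_filtration v w e f m"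
proof -
  note iff = unit_filtration_iff[OF assms(1-4)]
  have "(A - 1\<^sub>m (e * f)) * (B - 1\<^sub>m (e * f)) \<in> graded_mats e f m"
    using A B iff graded_mats_mult graded_mats_mono le_add1 by metis
  then show ?thesis
    using A B mult_minus_one[of A "e * f" B] unfolding iff by (auto intro: graded_mats_add)
qed

lemma unit_filtration_one:
  assumes "uniformizer v w" "1 \<le> e" "1 \<le> f" "1 \<le> m"
  shows "1\<^sub>m (e * f) \<in> unit_filtration v w e f m"
proof -
  have "1\<^sub>m (e * f) - 1\<^sub>m (e * f) = (0\<^sub>m (e * f) (e * f) :: 'a mat)" by (intro eq_matI) auto
  then show ?thesis
    unfolding unit_filtration_iff[OF assms] by (simp only: graded_mats_zero one_carrier_mat)
qed

text \<open>The inverse B lies in the order, so B - 1 = -B(A - 1) is again in the ideal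
  \<PP>^m.\<close>

lemma unit_filtration_inverse:
  assumes w: "uniformizer v w" and e: "1 \<le> e" and f: "1 \<le> f" and m: "1 \<le> m"
    and A: "A \<in> unit_filtration v w e f m"
  shows "\<exists>B \<in> unit_filtration v w e f m. B * A = 1\<^sub>m (e * f)"
proof -
  note iff = unit_filtration_iff[OF w e f m]
  have Ac: "A \<in> carrier_mat (e * f) (e * f)" and Ag: "A - 1\<^sub>m (e * f) \<in> graded_mats e f m"
    using A unfolding iff by auto
  obtain B where B: "B \<in> graded_mats e f 0" "B * A = 1\<^sub>m (e * f)"
    using A unfolding unit_filtration_def Units_def order_ring_simps graded_mats_0[OF e f] by auto
  note Bc = graded_matsD(1)[OF B(1)]
  have "B * (A - 1\<^sub>m (e * f)) = 1\<^sub>m (e * f) - B"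
    using Bc Ac B(2) by (simp add: mult_minus_distrib_mat[of _ "e * f" "e * f" _ "e * f"])
  then have "B - 1\<^sub>m (e * f) = - (B * (A - 1\<^sub>m (e * f)))"
    using Bc by (intro eq_matI) auto
  then have "B - 1\<^sub>m (e * f) \<in> graded_mats e f m"
    using graded_mats_mult[OF B(1) Ag] by (simp add: graded_mats_uminus)
  then show ?thesis using B Bc unfolding Bex_def iff by blast
qed

section \<open>The two isomorphisms\<close>

text \<open>The map \<open>A \<mapsto> A - 1\<close> sends U^m bijectively to \<PP>^m and U^n to
  \<PP>^n. Its defect of additivity is a product of two elements of \<PP>^m, hence in \<PP>^(2m),
  which is contained in \<PP>^n because n \<le> 2m.\<close>

lemma unit_filtration_quotient_iso:
  assumes w: "uniformizer v w" and e: "1 \<le> e" and f: "1 \<le> f"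
    and m: "1 \<le> m" and mn: "m < n" and n: "n \<le> 2 * m"
  defines "U \<equiv> unit_filtration v w e f" and "P \<equiv> rad_power v w e f"
  shows "U n \<lhd> mat_mult_group (e * f) (U m) \<and> P n \<lhd> mat_add_group (e * f) (P m) \<and>
    mat_mult_group (e * f) (U m) Mod U n \<cong> mat_add_group (e * f) (P m) Mod P n"
proof -
  let ?d = "e * f"
  have P: "P k = graded_mats e f k" for k
    unfolding P_def by (rule rad_power_eq_graded_mats[OF w e f])
  have U: "A \<in> U k \<longleftrightarrow> A \<in> carrier_mat ?d ?d \<and> A - 1\<^sub>m ?d \<in> P k" if "1 \<le> k" for A k
    unfolding U_def P by (rule unit_filtration_iff[OF w e f that])
  have n1: "1 \<le> n" using m mn by simp
  have PC: "P k \<subseteq> carrier_mat ?d ?d" for k unfolding P using graded_matsD(1) by blast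
  have PnPm: "P n \<subseteq> P m" unfolding P using graded_mats_mono mn by auto
  have comm: "comm_group (mat_add_group ?d (P m))"
    by (rule mat_add_group_is_comm_group[OF PC])
      (auto simp: P graded_mats_zero graded_mats_add graded_mats_uminus)
  show ?thesis
  proof (rule quotient_iso_of_hom_modulo[where \<phi> = "\<lambda>A. A - 1\<^sub>m ?d"])
    show "group (mat_mult_group ?d (U m))"
    proof (rule mat_mult_group_is_group)
      show "U m \<subseteq> carrier_mat ?d ?d" using U[OF m] by blast
    qed (unfold U_def, fact unit_filtration_one[OF w e f m], fact unit_filtration_mult[OF w e f m],
      fact unit_filtration_inverse[OF w e f m])
    show "subgroup (P n) (mat_add_group ?d (P m))"
      by (rule mat_add_group_subgroup[OF comm PC PnPm])
        (auto simp: P graded_mats_zero graded_mats_add graded_mats_uminus)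
  next
    fix A B assume "A \<in> carrier (mat_mult_group ?d (U m))" "B \<in> carrier (mat_mult_group ?d (U m))"
    then have A: "A \<in> carrier_mat ?d ?d" "A - 1\<^sub>m ?d \<in> P m"
      and B: "B \<in> carrier_mat ?d ?d" "B - 1\<^sub>m ?d \<in> P m"
      by (auto simp: mat_mult_group_def U[OF m])
    let ?x = "A - 1\<^sub>m ?d" and ?y = "B - 1\<^sub>m ?d"
    have "A * B - 1\<^sub>m ?d - (?x + ?y) = ?x * ?y"
      unfolding mult_minus_one[OF A(1) B(1)] using A B
      by (intro eq_matI) (auto simp del: index_mult_mat(1))
    moreover have "?x * ?y \<in> P n"
      using graded_mats_mult[of ?x e f m ?y m] graded_mats_mono[of _ e f "m + m" n] A B n
      by (auto simp: P)
    ultimately show "A \<otimes>\<^bsub>mat_mult_group ?d (U m)\<^esub> B - 1\<^sub>m ?d \<in>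
        P n #>\<^bsub>mat_add_group ?d (P m)\<^esub> (?x \<otimes>\<^bsub>mat_add_group ?d (P m)\<^esub> ?y)"
      using A B mat_add_group_r_cosetI[of "A * B - 1\<^sub>m ?d" "?x + ?y" "P n" ?d "P m"]
      by (simp add: minus_carrier_mat mat_mult_group_def mat_add_group_def)
  next
    fix y assume "y \<in> carrier (mat_add_group ?d (P m))"
    then have y: "y \<in> P m" "y \<in> carrier_mat ?d ?d" using PC by (auto simp: mat_add_group_def)
    have eq: "1\<^sub>m ?d + y - 1\<^sub>m ?d = y" and z: "y - y = 0\<^sub>m ?d ?d"
      using y(2) by (auto intro!: eq_matI)
    show "\<exists>A\<in>carrier (mat_mult_group ?d (U m)). A - 1\<^sub>m ?d \<in> P n #>\<^bsub>mat_add_group ?d (P m)\<^esub> y"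
      using y eq z mat_add_group_r_cosetI[of y y "P n" ?d]
      by (intro bexI[of _ "1\<^sub>m ?d + y"])
        (auto simp: mat_mult_group_def U[OF m] P graded_mats_zero)
  qed (use PnPm comm in \<open>auto simp: mat_mult_group_def mat_add_group_def U[OF m] U[OF n1]\<close>)
qed

text \<open>For det A = 1 the trace of A - 1 need not vanish, but it is small enough that removing
  it changes A - 1 only modulo \<PP>^n. Surjectivity needs a lift of determinant exactly 1, obtained
  by rescaling a row.\<close>

lemma unit_filtration_SL_quotient_iso:
  assumes w: "uniformizer v w" and e: "1 \<le> e" and f: "1 \<le> f"
    and m: "1 \<le> m" and mn: "m < n" and n: "n \<le> 2 * m"
  defines "U1 \<equiv> unit_filtration_SL v w e f" and "P0 \<equiv> \<lambda>k. trace_zero (rad_power v w e f k)"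
  shows "U1 n \<lhd> mat_mult_group (e * f) (U1 m) \<and> P0 n \<lhd> mat_add_group (e * f) (P0 m) \<and>
    mat_mult_group (e * f) (U1 m) Mod U1 n \<cong> mat_add_group (e * f) (P0 m) Mod P0 n"
proof -
  let ?d = "e * f"
  let ?P = "graded_mats e f" and ?U = "unit_filtration v w e f"
  have d: "0 < ?d" using e f by simp
  have n1: "1 \<le> n" using m mn by simp
  have P0: "A \<in> P0 k \<longleftrightarrow> A \<in> ?P k \<and> mat_trace A = 0" for A k
    unfolding P0_def trace_zero_def rad_power_eq_graded_mats[OF w e f] by simp
  have U1: "A \<in> U1 k \<longleftrightarrow> A \<in> carrier_mat ?d ?d \<and> A - 1\<^sub>m ?d \<in> ?P k \<and> det A = 1"
    if "1 \<le> k" for A k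
    unfolding U1_def unit_filtration_SL_def special_linear_def
    using unit_filtration_iff[OF w e f that] by auto
  have PC: "x \<in> carrier_mat ?d ?d" if "x \<in> ?P k" for x k using graded_matsD(1)[OF that] .
  have P0C: "P0 k \<subseteq> carrier_mat ?d ?d" for k using PC by (auto simp: P0)
  have PnPm: "x \<in> ?P m" if "x \<in> ?P n" for x using graded_mats_mono[OF that] mn by simp
  have zero: "0\<^sub>m ?d ?d \<in> P0 k" for k by (simp add: P0 graded_mats_zero mat_trace_def)
  have add: "A + B \<in> P0 k" if "A \<in> P0 k" "B \<in> P0 k" for A B k
    using that mat_trace_add[of A ?d B] PC[of _ k] by (auto simp: P0 graded_mats_add)
  have uminus: "- A \<in> P0 k" if "A \<in> P0 k" for A k
    using that mat_trace_uminus[of A ?d] PC[of _ k] by (auto simp: P0 graded_mats_uminus)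
  have comm: "comm_group (mat_add_group ?d (P0 m))"
    by (rule mat_add_group_is_comm_group[OF P0C zero add uminus])
  \<comment> \<open>The linear projection onto trace-zero matrices along E_00. Unlike subtraction of
    the scalar matrix (tr x)/d, it involves no division by d and so works in every
    characteristic.\<close>
  define \<tau> where "\<tau> x = x - corner_mat ?d (mat_trace x)" for x :: "'a mat"
  have \<tau>C: "\<tau> x \<in> carrier_mat ?d ?d" for x by (simp add: \<tau>_def minus_carrier_mat)
  have tr_\<tau>: "mat_trace (\<tau> x) = 0" if "x \<in> carrier_mat ?d ?d" for x
    using that mat_trace_diff[of x ?d "corner_mat ?d (mat_trace x)"]
    by (simp add: \<tau>_def mat_trace_corner[OF d])
  have \<tau>_P0: "\<tau> x \<in> P0 k" if "x \<in> ?P k" for x k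
    using that tr_\<tau>[OF PC[OF that]]
    by (auto simp: P0 \<tau>_def intro: graded_mats_diff corner_mat_graded mat_trace_graded)
  have \<tau>_diff: "\<tau> x - \<tau> y = \<tau> (x - y)" if "x \<in> carrier_mat ?d ?d" "y \<in> carrier_mat ?d ?d" for x y
    using that mat_trace_diff[OF that] by (intro eq_matI) (auto simp: \<tau>_def)
  have \<tau>_add: "\<tau> x + \<tau> y = \<tau> (x + y)" if "x \<in> carrier_mat ?d ?d" "y \<in> carrier_mat ?d ?d" for x y
    using that mat_trace_add[OF that] by (intro eq_matI) (auto simp: \<tau>_def)
  have det_mod: "det A - 1 - mat_trace (A - 1\<^sub>m ?d) \<in> scaled_ideal e (int n)"
    if "A \<in> carrier_mat ?d ?d" "A - 1\<^sub>m ?d \<in> ?P m" for A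
  proof -
    have "1\<^sub>m ?d + (A - 1\<^sub>m ?d) = A" using that(1) by (intro eq_matI) auto
    then show ?thesis
      using scaled_ideal_mono[OF det_one_plus_graded[OF that(2)]] n by simp
  qed
  \<comment> \<open>With det A = 1 the congruence \<open>det_mod\<close> reduces to a bound on -tr(A
    - 1).\<close>
  have tr_n: "mat_trace (A - 1\<^sub>m ?d) \<in> scaled_ideal e (int n)" if "A \<in> U1 m" for A
    using that det_mod[of A] scaled_ideal_uminus[of "- mat_trace (A - 1\<^sub>m ?d)" e "int n"]
    by (simp add: U1[OF m])
  show ?thesis
  proof (rule quotient_iso_of_hom_modulo[where \<phi> = "\<lambda>A. \<tau> (A - 1\<^sub>m ?d)"])
    have U_carrier: "?U m \<subseteq> carrier_mat ?d ?d"
      using unit_filtration_iff[OF w e f m] by blast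
    then have U1_eq: "U1 m = {A \<in> ?U m. det A = 1}"
      unfolding U1_def unit_filtration_SL_def special_linear_def by blast
    show "group (mat_mult_group ?d (U1 m))"
    proof (rule mat_mult_group_is_group)
      show "1\<^sub>m ?d \<in> U1 m" using unit_filtration_one[OF w e f m] by (simp add: U1_eq)
    next
      fix A B assume AB: "A \<in> U1 m" "B \<in> U1 m"
      then show "A * B \<in> U1 m"
        using unit_filtration_mult[OF w e f m] U_carrier det_mult[of A ?d B] by (auto simp: U1_eq)
    next
      fix A assume A: "A \<in> U1 m"
      then obtain B where B: "B \<in> ?U m" "B * A = 1\<^sub>m ?d"
        using unit_filtration_inverse[OF w e f m] by (auto simp: U1_eq)
      have "det B * det A = 1" using det_mult[of B ?d A] A B U1_eq U_carrier by auto
      then show "\<exists>B\<in>U1 m. B * A = 1\<^sub>m ?d" using A B by (auto simp: U1_eq)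
    qed (use U1_eq U_carrier in auto)
    show "subgroup (P0 n) (mat_add_group ?d (P0 m))"
      by (rule mat_add_group_subgroup[OF comm P0C _ zero add uminus]) (auto simp: P0 PnPm)
  next
    fix A B assume "A \<in> carrier (mat_mult_group ?d (U1 m))" "B \<in> carrier (mat_mult_group ?d (U1 m))"
    then have A: "A \<in> carrier_mat ?d ?d" "A - 1\<^sub>m ?d \<in> ?P m"
      and B: "B \<in> carrier_mat ?d ?d" "B - 1\<^sub>m ?d \<in> ?P m"
      by (auto simp: mat_mult_group_def U1[OF m])
    let ?x = "A - 1\<^sub>m ?d" and ?y = "B - 1\<^sub>m ?d"
    have "A * B - 1\<^sub>m ?d - (?x + ?y) = ?x * ?y"
      unfolding mult_minus_one[OF A(1) B(1)] using A B
      by (intro eq_matI) (auto simp del: index_mult_mat(1))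
    moreover have "?x * ?y \<in> ?P n"
      using graded_mats_mono[OF graded_mats_mult[OF A(2) B(2)]] n by simp
    \<comment> \<open>By additivity of \<tau> the defect is \<tau>(xy), and \<tau> maps \<PP>^n into
      its trace-zero part.\<close>
    ultimately have "\<tau> (A * B - 1\<^sub>m ?d) - (\<tau> ?x + \<tau> ?y) \<in> P0 n"
      using A B \<tau>_P0[of "?x * ?y" n] \<tau>_add[of ?x ?y] \<tau>_diff[of "A * B - 1\<^sub>m ?d" "?x + ?y"]
      by (auto simp: minus_carrier_mat)
    then show "\<tau> (A \<otimes>\<^bsub>mat_mult_group ?d (U1 m)\<^esub> B - 1\<^sub>m ?d) \<in>
        P0 n #>\<^bsub>mat_add_group ?d (P0 m)\<^esub> (\<tau> ?x \<otimes>\<^bsub>mat_add_group ?d (P0 m)\<^esub> \<tau> ?y)"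
      using \<tau>C mat_add_group_r_cosetI[of "\<tau> (A * B - 1\<^sub>m ?d)" "\<tau> ?x + \<tau> ?y" "P0 n" ?d "P0 m"]
      by (simp add: mat_mult_group_def mat_add_group_def)
  next
    fix y assume "y \<in> carrier (mat_add_group ?d (P0 m))"
    then have y: "y \<in> ?P m" "mat_trace y = 0" "y \<in> carrier_mat ?d ?d"
      using PC by (auto simp: mat_add_group_def P0)
    define C where "C = 1\<^sub>m ?d + y"
    have C: "C \<in> carrier_mat ?d ?d" "C - 1\<^sub>m ?d = y"
      unfolding C_def using y(3) by (auto intro!: eq_matI)
    \<comment> \<open>The trace term of \<open>det_mod\<close> vanishes, since C - 1 = y has trace
      zero.\<close>
    have "det C - 1 \<in> scaled_ideal e (int n)" using det_mod[of C] C y by simp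
    then have u: "det C \<noteq> 0" "inverse (det C) - 1 \<in> scaled_ideal e (int n)"
      using scaled_ideal_inverse_one_plus[of "int n" "det C" e] n1 by auto
    \<comment> \<open>Rescaling the first row of \<open>1 + y\<close> normalises its determinant and changes it only
      modulo \<open>\<PP>\<^sup>n\<close>, because the trace of \<open>y\<close> vanishes.\<close>
    define A where "A = multrow 0 (inverse (det C)) C"
    have Ac: "A \<in> carrier_mat ?d ?d" using C(1) by (simp add: A_def)
    have det: "det A = 1" using u(1) det_multrow[OF d C(1)] by (simp add: A_def)
    have diff: "A - 1\<^sub>m ?d - y \<in> ?P n"
    proof (rule graded_matsI)
      fix i j assume ij: "i < ?d" "j < ?d"
      \<comment> \<open>Degree 0 suffices for C: the factor 1/det C - 1 supplies the full degree
        n.\<close>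
      have C0: "C $$ (i, j) \<in> scaled_ideal e (int (i div f) - int (j div f))"
      proof -
        have "y $$ (i, j) \<in> scaled_ideal e (int (i div f) - int (j div f))"
          using scaled_ideal_mono[OF graded_matsD(2)[OF y(1) ij]] by simp
        then show ?thesis
          unfolding C_def using ij y(3) by (auto intro!: scaled_ideal_add one_scaled_ideal)
      qed
      \<comment> \<open>This is A - C, which is zero outside the rescaled first row.\<close>
      have "(A - 1\<^sub>m ?d - y) $$ (i, j) =
          (if i = 0 then (inverse (det C) - 1) * C $$ (i, j) else 0)"
        using ij y(3) C by (auto simp: A_def C_def algebra_simps)
      then show "(A - 1\<^sub>m ?d - y) $$ (i, j) \<in>
          scaled_ideal e (int n + int (i div f) - int (j div f))"
        using scaled_ideal_mult[OF u(2) C0] by (cases "i = 0") (simp_all add: add_diff_eq)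
    qed (use y(3) in \<open>simp add: minus_carrier_mat\<close>)
    have "A - 1\<^sub>m ?d = (A - 1\<^sub>m ?d - y) + y" using Ac y(3) by (intro eq_matI) auto
    then have "A - 1\<^sub>m ?d \<in> ?P m" using graded_mats_add[OF PnPm[OF diff] y(1)] by simp
    then have "A \<in> U1 m" using Ac det by (simp add: U1[OF m])
    \<comment> \<open>Hence closeness of \<tau>(A - 1) to \<tau>(y) is closeness to y
      itself.\<close>
    moreover have "\<tau> y = y" using y by (intro eq_matI) (auto simp: \<tau>_def)
    moreover have "\<tau> (A - 1\<^sub>m ?d) - \<tau> y \<in> P0 n"
      using \<tau>_P0[OF diff] \<tau>_diff[of "A - 1\<^sub>m ?d" y] Ac y(3) by (simp add: minus_carrier_mat)
    ultimately show "\<exists>A\<in>carrier (mat_mult_group ?d (U1 m)).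
        \<tau> (A - 1\<^sub>m ?d) \<in> P0 n #>\<^bsub>mat_add_group ?d (P0 m)\<^esub> y"
      using mat_add_group_r_cosetI[of "\<tau> (A - 1\<^sub>m ?d)" y "P0 n" ?d] \<tau>C y(3)
      by (auto simp: mat_mult_group_def)
  next
    have "A \<in> U1 n" if "A \<in> U1 m" "\<tau> (A - 1\<^sub>m ?d) \<in> P0 n" for A
    proof -
      let ?x = "A - 1\<^sub>m ?d"
      have Ac: "A \<in> carrier_mat ?d ?d" using that(1) by (simp add: U1[OF m])
      \<comment> \<open>The removed corner lies in \<PP>^n by \<open>tr_n\<close>, so \<tau>(x) in
        \<PP>^n forces x in \<PP>^n; thus the kernel is no larger than \<open>U1 n\<close>.\<close>
      have "?x = \<tau> ?x + corner_mat ?d (mat_trace ?x)"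
        unfolding \<tau>_def using Ac by (intro eq_matI) auto
      moreover have "\<tau> ?x \<in> ?P n" using that(2) by (simp add: P0)
      ultimately have "?x \<in> ?P n"
        using graded_mats_add[OF _ corner_mat_graded[OF tr_n[OF that(1)]], of "\<tau> ?x"] by metis
      then show ?thesis using that(1) by (simp add: U1[OF m] U1[OF n1])
    qed
    moreover have "A \<in> U1 m \<and> \<tau> (A - 1\<^sub>m ?d) \<in> P0 n" if "A \<in> U1 n" for A
      using that PnPm \<tau>_P0 by (auto simp: U1[OF m] U1[OF n1])
    ultimately show "{A \<in> carrier (mat_mult_group ?d (U1 m)). \<tau> (A - 1\<^sub>m ?d) \<in> P0 n} = U1 n"
      by (auto simp: mat_mult_group_def)
  qed (use comm \<tau>_P0 in \<open>auto simp: mat_mult_group_def mat_add_group_def U1[OF m]\<close>)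
qed

end

theorem proposition7p4:
  fixes v :: "'a::field \<Rightarrow> int" and w :: 'a and e f m n :: nat
  assumes "nonarch_local_field v"
    and "uniformizer v w"
    and "1 \<le> e" and "1 \<le> f"
    and "1 \<le> m" and "m < n" and "n \<le> 2 * m"
  defines "U \<equiv> unit_filtration v w e f" and "U1 \<equiv> unit_filtration_SL v w e f"
    and "P \<equiv> rad_power v w e f"
    and "d \<equiv> e * f"
  shows "(U n \<lhd> mat_mult_group d (U m) \<and> P n \<lhd> mat_add_group d (P m) \<and>
           mat_mult_group d (U m) Mod U n \<cong> mat_add_group d (P m) Mod P n) \<and>
         (U1 n \<lhd> mat_mult_group d (U1 m) \<and>
           trace_zero (P n) \<lhd> mat_add_group d (trace_zero (P m)) \<and>
           mat_mult_group d (U1 m) Mod U1 n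
             \<cong> mat_add_group d (trace_zero (P m)) Mod trace_zero (P n))"
  unfolding U_def U1_def P_def d_def
  using nonarch_local_field.unit_filtration_quotient_iso[OF assms(1-7)]
    nonarch_local_field.unit_filtration_SL_quotient_iso[OF assms(1-7)] by blast

end
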